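(* Let $V$ be a vertex operator algebra and $g_1,g_2,g_3$ automorphisms of $V$ of finite order with $g_1g_2=g_3$ such that one of the following holds: (1) $g_1=\mathrm{id}$; (2) each of $g_1,g_2,g_3$ generates the same cyclic group. For $k=1,2,3$ let $M^k$ be an (admissible) $g_k$-twisted $V$-module of conformal weight $h_k$, and set $h=h_1+h_2-h_3$. Then, as vector spaces, $$\mathscr C\big(\Sigma((M^3)',M^1,M^2)\big)\cong\mathfrak I\binom{M^3}{M^1\ M^2},$$ where the right-hand side is the space of twisted intertwining operators of type $\binom{M^3}{M^1\,M^2}$ and $\Sigma$ stands for $\Sigma_1((M^3)',M^1,M^2)=(\mathbf x\colon\bar C\to\mathbb P^1,\infty,1,0,(M^3)',M^1,M^2)$ in case (1), and for $\Sigma_w((M^3)',M^1,M^2)=(\mathbf x\colon\bar C_w\to\mathbb P^1,\infty,w,0,(M^3)',M^1,M^2)$, $w\in\mathbb C^\times$, in case (2); $\mathscr C$ denotes the space of twisted conformal blocks.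
   Context: Everything is over $\mathbb C$; $\mathbb N=\{0,1,2,\dots\}$. VOAs and twisted modules. A vertex operator algebra $V=\bigoplus_{k\in\mathbb N}V_k$ is $\mathbb N$-graded with $\dim V_k<\infty$, has vertex operators $Y(a,z)=\sum_{n\in\mathbb Z}a_{(n)}z^{-n-1}$, vacuum $\mathbf 1\in V_0$, conformal vector $\omega\in V_2$ with $Y(\omega,z)=\sum L_nz^{-n-2}$, and satisfies the usual axioms; $\mathrm{wt}\,a=k$ for $a\in V_k$. Automorphisms are linear automorphisms $g$ fixing $\mathbf 1,\omega$ with $gY(a,z)g^{-1}=Y(ga,z)$. If $g^T=1$, $V_g^r=\{a: ga=e^{2\pi ir/T}a\}$, $0\le r\le T-1$. A weak $g$-twisted $V$-module has $Y_M(a,z)=\sum_{n\in\frac1T\mathbb Z}a_{(n)}z^{-n-1}$ with truncation, $Y_M(\mathbf 1,z)=\mathrm{id}$, only $n\in\frac rT+\mathbb Z$ for $a\in V_g^r$, and the usual twisted Jacobi identity; it is admissible if $M=\bigoplus_{n\in\frac1T\mathbb N}M(n)$ with $a_{(m)}M(n)\subset M(\mathrm{wt}\,a-m-1+n)$; it has conformal weight $h$ if $L_0=h+n$ on $M(n)$. The contragredient of an admissible $g$-twisted module $M$ is the admissible $g^{-1}$-twisted module $M'=\bigoplus_nM(n)^*$ with $\langle a_{(n)}u',u\rangle=\big\langle u',\sum_{j\ge0}\frac{(-1)^{\mathrm{wt}\,a}}{j!}(L_1^ja)_{(2\mathrm{wt}\,a-n-j-2)}u\big\rangle$. In case (1),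 $T$ is the order of $g_2=g_3$ and we put $\epsilon=0$; in case (2), $T$ is the common order and $g_1=g_2^\epsilon$ with $\epsilon\in\mathbb Z$. Put $V^r=V_{g_2}^r$. Twisted intertwining operators. A twisted intertwining operator of type $\binom{M^3}{M^1\,M^2}$ is a linear map $I(\cdot,w)\colon M^1\to w^{-h}\mathrm{Hom}(M^2,M^3)[[w^{\pm1/T}]]$, $I(v,w)=\sum_{n\in\frac1T\mathbb Z}v_{(n)}w^{-n-h-1}$, such that: (I1) for $v\in M^1,v_2\in M^2$, $v_{(n)}v_2=0$ for $n\gg0$; (I2) for $a\in V^r$, $v\in M^1$ and every $F(z,w)\in z^{r/T}(z-w)^{\epsilon r/T}\mathbb C[z^{\pm1},(z-w)^{\pm1}]$, $$\mathrm{Res}_zY_{M^3}(a,z)I(v,w)\iota_{z^{-1}}F-\mathrm{Res}_zI(v,w)Y_{M^2}(a,z)\iota_zF=\mathrm{Res}_{z-w}I(Y_{M^1}(a,z-w)v,w)\iota_{z-w}F,$$ where $\iota_{z^{-1}},\iota_z,\iota_{z-w}$ are the expansions in $|z|>|w|$, $|z|<|w|$, $|z-w|<|w|$ (with a fixed choice of $(-w)^{1/T}$); (I3) $I(L_{-1}v,w)=\partial_wI(v,w)$. $\mathfrak I\binom{M^3}{M^1\,M^2}$ is the space of them. Curves. $\mathbf x\colon\bar C\to\mathbb P^1$ is the cyclic cover $z=(z^{1/T})^T$ of $\mathbb P^1$ with branch points $0,\infty$, Galois group acting on $V$ with Deck generators $g_2$ at $0$ and $g_2^{-1}$ at $\infty$.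 $\mathbf x\colon\bar C_w\to\mathbb P^1$ is the cyclic cover of order $T$ given by the smooth projective model of $y^T=x^a(x-w)^b$ ($a,b,a+b$ coprime to $T$), $(x,y)\mapsto x=:z$, with branch points $0,w,\infty$, whose Galois group acts on $V$ so that the Deck generators at $w,0,\infty$ are $g_1,g_2,g_3^{-1}$. The Deck generator at a totally ramified point $q$ is the element $g_q$ of the Galois group with $s\circ g_q=e^{2\pi i/T}s$ for a local coordinate $s$ upstairs whose $T$-th power is a local coordinate downstairs. Twisted conformal blocks. Let $w=1$ in case (1). The twisted chiral Lie algebra on $\mathbb P^1\setminus\{0,w,\infty\}$ is the space $\mathcal L$ spanned by the classes of $\alpha=a\otimes f\,dz$, $a\in V^r$ homogeneous, $f\in z^{r/T}(z-w)^{\epsilon r/T}\mathbb C[z^{\pm1},(z-w)^{-1}]$, modulo the image of $L_{-1}\otimes1+1\otimes\partial_z$, with bracket $[a\otimes f\,dz,b\otimes f'dz]=\sum_{j\ge0}\frac1{j!}(a_{(j)}b)\otimes(\partial_z^jf)f'dz$. It acts on $(M^3)'\otimes M^1\otimes M^2$ as the sum of its actions at $\infty,w,0$: on $M^2$ by $\mathrm{Res}_zY_{M^2}(a,z)\iota_zf$; on $M^1$ by $\mathrm{Res}_{z-w}Y_{M^1}(a,z-w)\iota_{z-w}f$; and on $(M^3)'$ by minus the transpose of $\mathrm{Res}_zY_{M^3}(a,z)\iota_{z^{-1}}f$. A twisted conformal block is a linear functional on $(M^3)'\otimes M^1\otimes M^2$ vanishing on $\mathcal L.((M^3)'\otimes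 M^1\otimes M^2)$. (Fibres of the modules at the marked points are identified with the modules through the coordinates $z^{1/T}$ at $0$, $(z-w)^{1/T}$ or $z-w$ at $w$, $z^{-1/T}$ at $\infty$.)
   Formalization: Every graded piece M^3(n) is assumed finite-dimensional; without this the claim fails: for V=C, ω=0, M^1=M^2=C and M^3=M^3(0) infinite-dimensional, intertwining operators form M^3 but conformal blocks form its double dual. *)

theory Defs
  imports Complex_Main
    "HOL-Library.Function_Algebras"
    "HOL-Library.Poly_Mapping"
begin

section \<open>Complex vector spaces\<close>

class complex_vec = ab_group_add +
  fixes scaleC :: "complex \<Rightarrow> 'a \<Rightarrow> 'a"  (infixr "*\<^sub>C" 75)
  assumes scaleC_add_right: "c *\<^sub>C (x + y) = c *\<^sub>C x + c *\<^sub>C y"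
    and scaleC_add_left: "(c + d) *\<^sub>C x = c *\<^sub>C x + d *\<^sub>C x"
    and scaleC_scaleC: "c *\<^sub>C d *\<^sub>C x = (c * d) *\<^sub>C x"
    and scaleC_one: "1 *\<^sub>C x = x"

global_interpretation cvec: vector_space "scaleC :: complex \<Rightarrow> 'a \<Rightarrow> 'a::complex_vec"
  by standard (simp_all add: scaleC_add_right scaleC_add_left scaleC_scaleC scaleC_one)

abbreviation clinear :: "('a::complex_vec \<Rightarrow> 'b::complex_vec) \<Rightarrow> bool" where
  "clinear \<equiv> Vector_Spaces.linear scaleC scaleC"

instantiation complex :: complex_vec
begin
definition scaleC_complex :: "complex \<Rightarrow> complex \<Rightarrow> complex" where
  "scaleC_complex c x = c * x"
instance
  by standard (simp_all add: scaleC_complex_def algebra_simps)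
end

instantiation "fun" :: (type, complex_vec) complex_vec
begin
definition scaleC_fun :: "complex \<Rightarrow> ('a \<Rightarrow> 'b) \<Rightarrow> 'a \<Rightarrow> 'b" where
  "scaleC_fun c f = (\<lambda>x. c *\<^sub>C f x)"
instance
  by standard (simp_all add: scaleC_fun_def fun_eq_iff scaleC_add_right scaleC_add_left
      scaleC_scaleC scaleC_one)
end

definition clinear_on :: "'a::complex_vec set \<Rightarrow> ('a \<Rightarrow> 'b::complex_vec) \<Rightarrow> bool" where
  "clinear_on S f \<longleftrightarrow>
     (\<forall>x\<in>S. \<forall>y\<in>S. f (x + y) = f x + f y) \<and> (\<forall>c. \<forall>x\<in>S. f (c *\<^sub>C x) = c *\<^sub>C f x)"

definition clinear_isomorphic :: "'a::complex_vec set \<Rightarrow> 'b::complex_vec set \<Rightarrow> bool" where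
  "clinear_isomorphic S S' \<longleftrightarrow>
     cvec.subspace S \<and> cvec.subspace S' \<and> (\<exists>f. clinear_on S f \<and> bij_betw f S S')"

definition cfinite_dim :: "'a::complex_vec set \<Rightarrow> bool" where
  "cfinite_dim S \<longleftrightarrow> (\<exists>B. finite B \<and> S \<subseteq> cvec.span B)"

definition direct_sum_decomposition :: "('i \<Rightarrow> 'a::complex_vec set) \<Rightarrow> bool" where
  "direct_sum_decomposition G \<longleftrightarrow>
     (\<forall>i. cvec.subspace (G i)) \<and>
     (\<forall>x. \<exists>!f. (\<forall>i. f i \<in> G i) \<and> finite {i. f i \<noteq> 0} \<and> x = Sum_any f)"


section \<open>Tensor products of three vector spaces\<close>

text \<open>
  The tensor product of a subspace \<^term>\<open>A\<close> of the first type with the (full) second and third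
  types. The pure tensor of \<^term>\<open>a\<close>, \<^term>\<open>b\<close>, \<^term>\<open>c\<close> is realised as evaluation of trilinear
  forms at \<^term>\<open>(a, b, c)\<close>. As trilinear forms separate the points of a tensor product of vector
  spaces over a field, the span of these evaluations is the tensor product; its universal
  property (for scalar-valued forms) is recorded in the lemmas below.
\<close>

definition trilinear_on ::
    "'a::complex_vec set \<Rightarrow> ('a \<Rightarrow> 'b::complex_vec \<Rightarrow> 'c::complex_vec \<Rightarrow> complex) \<Rightarrow> bool" where
  "trilinear_on A \<beta> \<longleftrightarrow>
     (\<forall>b c. clinear_on A (\<lambda>a. \<beta> a b c)) \<and>
     (\<forall>a\<in>A. \<forall>c. clinear (\<lambda>b. \<beta> a b c)) \<and>
     (\<forall>a\<in>A. \<forall>b. clinear (\<beta> a b))"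

definition pure_tensor :: "'a::complex_vec set \<Rightarrow> 'a \<Rightarrow> 'b::complex_vec \<Rightarrow> 'c::complex_vec \<Rightarrow>
    ('a \<Rightarrow> 'b \<Rightarrow> 'c \<Rightarrow> complex) \<Rightarrow> complex" where
  "pure_tensor A a b c = (\<lambda>\<beta>. if trilinear_on A \<beta> then \<beta> a b c else 0)"

definition tensor_space :: "'a::complex_vec set \<Rightarrow>
    (('a \<Rightarrow> 'b::complex_vec \<Rightarrow> 'c::complex_vec \<Rightarrow> complex) \<Rightarrow> complex) set" where
  "tensor_space A = cvec.span {pure_tensor A a b c | a b c. a \<in> A}"

lemma tensor_space_lift:
  assumes "trilinear_on A \<beta>"
  shows "\<exists>\<phi>. clinear_on (tensor_space A) \<phi> \<and> (\<forall>a\<in>A. \<forall>b c. \<phi> (pure_tensor A a b c) = \<beta> a b c)"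
  using assms
  by (intro exI[of _ "\<lambda>x. x \<beta>"])
     (simp add: clinear_on_def pure_tensor_def scaleC_fun_def scaleC_complex_def)

lemma clinear_on_span_eq:
  assumes \<phi>: "clinear_on (cvec.span B) \<phi>" and \<psi>: "clinear_on (cvec.span B) \<psi>"
    and eq: "\<And>b. b \<in> B \<Longrightarrow> \<phi> b = \<psi> b" and x: "x \<in> cvec.span B"
  shows "\<phi> x = \<psi> x"
proof -
  have zero: "\<theta> 0 = 0" if "clinear_on (cvec.span B) \<theta>" for \<theta> :: "'a \<Rightarrow> 'b"
  proof -
    have "\<theta> (0 *\<^sub>C 0) = 0 *\<^sub>C \<theta> 0"
      using that cvec.span_zero[of B] unfolding clinear_on_def by blast
    then show ?thesis by simp
  qed
  have "cvec.subspace {y \<in> cvec.span B. \<phi> y = \<psi> y}"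
    using zero[OF \<phi>] zero[OF \<psi>] \<phi> \<psi>
    by (intro cvec.subspaceI)
       (auto simp: clinear_on_def cvec.span_zero cvec.span_add cvec.span_scale)
  then have "cvec.span B \<subseteq> {y \<in> cvec.span B. \<phi> y = \<psi> y}"
    by (intro cvec.span_minimal) (auto simp: eq cvec.span_base)
  then show ?thesis using x by blast
qed

lemma tensor_space_lift_unique:
  assumes "clinear_on (tensor_space A) \<phi>" and "clinear_on (tensor_space A) \<psi>"
    and "\<And>a b c. a \<in> A \<Longrightarrow> \<phi> (pure_tensor A a b c) = \<psi> (pure_tensor A a b c)"
    and "x \<in> tensor_space A"
  shows "\<phi> x = \<psi> x"
  using assms clinear_on_span_eq[of "{pure_tensor A a b c | a b c. a \<in> A}" \<phi> \<psi> x]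
  unfolding tensor_space_def by blast


section \<open>Vertex operator algebras and their automorphisms\<close>

text \<open>\<^term>\<open>vprod V a n b\<close> is the product of \<^term>\<open>a\<close> and \<^term>\<open>b\<close> with index \<^term>\<open>n\<close>, i.e. the
  coefficient of \<open>z\<close> to the power \<open>-n-1\<close> in \<open>Y(a,z)b\<close>.\<close>

record 'v voa =
  wt_space :: "nat \<Rightarrow> 'v set"
  vprod :: "'v \<Rightarrow> int \<Rightarrow> 'v \<Rightarrow> 'v"
  vacuum :: 'v
  conformal :: 'v

definition Vir :: "'v::complex_vec voa \<Rightarrow> int \<Rightarrow> 'v \<Rightarrow> 'v" where
  "Vir V n = vprod V (conformal V) (n + 1)"

text \<open>The Jacobi identity is stated through its coefficients (Borcherds' identity). All sums over
  \<^term>\<open>j::nat\<close> have finite support by truncation.\<close>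

definition vertex_operator_algebra :: "'v::complex_vec voa \<Rightarrow> bool" where
  "vertex_operator_algebra V \<longleftrightarrow>
     direct_sum_decomposition (wt_space V) \<and>
     (\<forall>k. cfinite_dim (wt_space V k)) \<and>
     vacuum V \<in> wt_space V 0 \<and> conformal V \<in> wt_space V 2 \<and>
     (\<forall>n b. clinear (\<lambda>a. vprod V a n b)) \<and> (\<forall>a n. clinear (vprod V a n)) \<and>
     (\<forall>a b. \<exists>N. \<forall>n\<ge>N. vprod V a n b = 0) \<and>
     (\<forall>n b. vprod V (vacuum V) n b = (if n = -1 then b else 0)) \<and>
     (\<forall>a. vprod V a (-1) (vacuum V) = a \<and> (\<forall>n\<ge>0. vprod V a n (vacuum V) = 0)) \<and>
     (\<forall>a b c p q n.
        Sum_any (\<lambda>j::nat. ((of_int p :: complex) gchoose j)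
            *\<^sub>C vprod V (vprod V a (n + int j) b) (p + q - int j) c) =
        Sum_any (\<lambda>j::nat. ((-1) ^ j * ((of_int n :: complex) gchoose j)) *\<^sub>C
           (vprod V a (p + n - int j) (vprod V b (q + int j) c)
            - ((-1) powi n) *\<^sub>C vprod V b (q + n - int j) (vprod V a (p + int j) c)))) \<and>
     (\<exists>cc::complex. \<forall>m n a.
        Vir V m (Vir V n a) - Vir V n (Vir V m a) =
        of_int (m - n) *\<^sub>C Vir V (m + n) a
          + (if m + n = 0 then (of_int (m ^ 3 - m) / 12 * cc) *\<^sub>C a else 0)) \<and>
     (\<forall>k. \<forall>a\<in>wt_space V k. Vir V 0 a = of_nat k *\<^sub>C a) \<and>
     (\<forall>a n b. vprod V (Vir V (-1) a) n b = - (of_int n *\<^sub>C vprod V a (n - 1) b))"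

definition voa_automorphism :: "'v::complex_vec voa \<Rightarrow> ('v \<Rightarrow> 'v) \<Rightarrow> bool" where
  "voa_automorphism V g \<longleftrightarrow>
     clinear g \<and> bij g \<and> g (vacuum V) = vacuum V \<and> g (conformal V) = conformal V \<and>
     (\<forall>a n b. g (vprod V a n b) = vprod V (g a) n (g b))"

definition finite_order :: "('a \<Rightarrow> 'a) \<Rightarrow> bool" where
  "finite_order g \<longleftrightarrow> (\<exists>n>0. g ^^ n = id)"

definition fun_order :: "('a \<Rightarrow> 'a) \<Rightarrow> nat" where
  "fun_order g = (LEAST n. n > 0 \<and> g ^^ n = id)"

definition fun_zpow :: "('a \<Rightarrow> 'a) \<Rightarrow> int \<Rightarrow> 'a \<Rightarrow> 'a" where
  "fun_zpow g k = (if k \<ge> 0 then g ^^ nat k else inv g ^^ nat (- k))"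

definition cyclic_group_of :: "('a \<Rightarrow> 'a) \<Rightarrow> ('a \<Rightarrow> 'a) set" where
  "cyclic_group_of g = range (fun_zpow g)"

definition eigenspace :: "('v::complex_vec \<Rightarrow> 'v) \<Rightarrow> nat \<Rightarrow> 'v set" where
  "eigenspace g r = {a. g a = cis (2 * pi * real r / real (fun_order g)) *\<^sub>C a}"


section \<open>Twisted modules\<close>

text \<open>\<^term>\<open>tmode M a n\<close> is the coefficient of \<open>z\<close> to the power \<open>-n-1\<close> in \<open>Y\<^sub>M(a,z)\<close>,
  for rational \<^term>\<open>n\<close>; it vanishes off the exponents that are allowed to occur.\<close>

record ('v, 'm) tmod =
  tmode :: "'v \<Rightarrow> rat \<Rightarrow> 'm \<Rightarrow> 'm"
  tdeg :: "rat \<Rightarrow> 'm set"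

text \<open>With \<^term>\<open>a\<close> in the \<^term>\<open>r\<close>-th eigenspace, the last conjunct is the coefficient form of the twisted
  Jacobi identity whose right-hand side is
  \<open>z\<^sub>2\<^sup>-\<^sup>1 ((z\<^sub>1-z\<^sub>0)/z\<^sub>2)\<^sup>-\<^sup>r\<^sup>/\<^sup>T \<delta>((z\<^sub>1-z\<^sub>0)/z\<^sub>2) Y\<^sub>M(Y(a,z\<^sub>0)b,z\<^sub>2)\<close>: multiply by
  \<open>z\<^sub>1\<^sup>p z\<^sub>0\<^sup>n z\<^sub>2\<^sup>q\<close> and take residues.\<close>

definition weak_twisted_module ::
    "'v::complex_vec voa \<Rightarrow> ('v \<Rightarrow> 'v) \<Rightarrow> ('v, 'm::complex_vec) tmod \<Rightarrow> bool" where
  "weak_twisted_module V g M \<longleftrightarrow>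
     (\<forall>n u. clinear (\<lambda>a. tmode M a n u)) \<and> (\<forall>a n. clinear (tmode M a n)) \<and>
     (\<forall>a u. \<exists>N. \<forall>n\<ge>N. tmode M a n u = 0) \<and>
     (\<forall>n u. tmode M (vacuum V) n u = (if n = -1 then u else 0)) \<and>
     (\<forall>r < fun_order g. \<forall>a \<in> eigenspace g r. \<forall>n.
        n - of_nat r / of_nat (fun_order g) \<notin> \<int> \<longrightarrow> tmode M a n = 0) \<and>
     (\<forall>r < fun_order g. \<forall>a \<in> eigenspace g r. \<forall>b u p q (n::int).
        p - of_nat r / of_nat (fun_order g) \<in> \<int> \<longrightarrow>
        Sum_any (\<lambda>j::nat. ((of_rat p :: complex) gchoose j)
            *\<^sub>C tmode M (vprod V a (n + int j) b) (p + q - of_nat j) u) =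
        Sum_any (\<lambda>j::nat. ((-1) ^ j * ((of_int n :: complex) gchoose j)) *\<^sub>C
           (tmode M a (p + of_int n - of_nat j) (tmode M b (q + of_nat j) u)
            - ((-1) powi n) *\<^sub>C tmode M b (q + of_int n - of_nat j) (tmode M a (p + of_nat j) u))))"

definition admissible_twisted_module ::
    "'v::complex_vec voa \<Rightarrow> ('v \<Rightarrow> 'v) \<Rightarrow> ('v, 'm::complex_vec) tmod \<Rightarrow> bool" where
  "admissible_twisted_module V g M \<longleftrightarrow>
     weak_twisted_module V g M \<and>
     direct_sum_decomposition (tdeg M) \<and>
     (\<forall>n. of_nat (fun_order g) * n \<notin> \<nat> \<longrightarrow> tdeg M n = {0}) \<and>
     (\<forall>k. \<forall>a \<in> wt_space V k. \<forall>m n. \<forall>u \<in> tdeg M n.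
        tmode M a m u \<in> tdeg M (of_nat k - m - 1 + n))"

definition has_conformal_weight ::
    "'v::complex_vec voa \<Rightarrow> ('v, 'm::complex_vec) tmod \<Rightarrow> complex \<Rightarrow> bool" where
  "has_conformal_weight V M h \<longleftrightarrow>
     (\<forall>n. \<forall>u \<in> tdeg M n. tmode M (conformal V) 1 u = (h + of_rat n) *\<^sub>C u)"

text \<open>The dual of \<open>M(n)\<close> is identified with the functionals on \<open>M\<close> that vanish on all other
  graded pieces; the contragredient is their direct sum. Its module structure enters conformal
  blocks only through the transposed action \<open>act_inf\<close> below.\<close>

definition dual_deg :: "('v, 'm::complex_vec) tmod \<Rightarrow> rat \<Rightarrow> ('m \<Rightarrow> complex) set" where
  "dual_deg M n = {\<psi>. clinear \<psi> \<and> (\<forall>k. k \<noteq> n \<longrightarrow> (\<forall>u \<in> tdeg M k. \<psi> u = 0))}"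

definition contragredient_space :: "('v, 'm::complex_vec) tmod \<Rightarrow> ('m \<Rightarrow> complex) set" where
  "contragredient_space M = cvec.span (\<Union>n. dual_deg M n)"


section \<open>Expansions of twisted Laurent polynomials\<close>

text \<open>
  A finite combination \<open>F\<close> of monomials \<open>z\<^sup>p (z-w)\<^sup>q\<close> is a \<^typ>\<open>rat \<times> rat \<Rightarrow>\<^sub>0 complex\<close>.
  \<open>twisted_laurent T \<epsilon> r\<close> is the space \<open>z\<^sup>r\<^sup>/\<^sup>T (z-w)\<^sup>\<epsilon>\<^sup>r\<^sup>/\<^sup>T \<complex>[z\<^sup>\<plusminus>\<^sup>1,(z-w)\<^sup>\<plusminus>\<^sup>1]\<close>. For a fixed nonzero
  number \<open>w\<close> the last factor equals \<open>\<complex>[z\<^sup>\<plusminus>\<^sup>1,(z-w)\<^sup>-\<^sup>1]\<close>; the presentation of a function by monomials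
  is then no longer unique, but its expansions do not depend on it.
\<close>

definition twisted_laurent :: "nat \<Rightarrow> int \<Rightarrow> nat \<Rightarrow> (rat \<times> rat \<Rightarrow>\<^sub>0 complex) set" where
  "twisted_laurent T \<epsilon> r =
     {F. \<forall>(p, q) \<in> Poly_Mapping.keys F.
           p - of_nat r / of_nat T \<in> \<int> \<and> q - of_int \<epsilon> * of_nat r / of_nat T \<in> \<int>}"

text \<open>
  Coefficients of \<open>z\<^sup>p (z-w)\<^sup>q\<close> in the three regions. In \<open>mono_inf\<close> and \<open>mono_zero\<close> the arguments
  \<open>k\<close>, \<open>e\<close> are the exponents of \<open>z\<close> and \<open>w\<close>, in \<open>mono_w\<close> those of \<open>z-w\<close> and \<open>w\<close>:

  \<open>|z|>|w|\<close>:  sum over \<open>l\<close> of  \<open>binom(q,l) (-w)\<^sup>l z\<^sup>p\<^sup>+\<^sup>q\<^sup>-\<^sup>l\<close>;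

  \<open>|z|<|w|\<close>:  sum over \<open>l\<close> of  \<open>binom(q,l) (-w)\<^sup>q\<^sup>-\<^sup>l z\<^sup>p\<^sup>+\<^sup>l\<close>;

  \<open>|z-w|<|w|\<close>:  sum over \<open>l\<close> of  \<open>binom(p,l) w\<^sup>p\<^sup>-\<^sup>l (z-w)\<^sup>q\<^sup>+\<^sup>l\<close>.

  The chosen root \<open>(-w)\<^sup>1\<^sup>/\<^sup>T\<close> is \<open>\<zeta> w\<^sup>1\<^sup>/\<^sup>T\<close>, where \<open>\<zeta>\<^sup>T = -1\<close>. Each index set below has at most one
  element; the arguments of the floor are integers whenever this matters.
\<close>

definition mono_inf :: "rat \<Rightarrow> rat \<Rightarrow> rat \<Rightarrow> rat \<Rightarrow> complex" where
  "mono_inf p q k e =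
     (\<Sum>l::nat | k = p + q - of_nat l \<and> e = of_nat l. ((of_rat q :: complex) gchoose l) * (-1) ^ l)"

definition mono_zero :: "nat \<Rightarrow> complex \<Rightarrow> rat \<Rightarrow> rat \<Rightarrow> rat \<Rightarrow> rat \<Rightarrow> complex" where
  "mono_zero T \<zeta> p q k e =
     (\<Sum>l::nat | k = p + of_nat l \<and> e = q - of_nat l.
        ((of_rat q :: complex) gchoose l) * \<zeta> powi \<lfloor>of_nat T * (q - of_nat l)\<rfloor>)"

definition mono_w :: "rat \<Rightarrow> rat \<Rightarrow> rat \<Rightarrow> rat \<Rightarrow> complex" where
  "mono_w p q k e =
     (\<Sum>l::nat | k = q + of_nat l \<and> e = p - of_nat l. ((of_rat p :: complex) gchoose l))"

definition expand ::
    "(rat \<Rightarrow> rat \<Rightarrow> rat \<Rightarrow> rat \<Rightarrow> complex) \<Rightarrow> (rat \<times> rat \<Rightarrow>\<^sub>0 complex) \<Rightarrow> rat \<Rightarrow> rat \<Rightarrow> complex" where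
  "expand \<iota> F k e = (\<Sum>(p, q) \<in> Poly_Mapping.keys F. Poly_Mapping.lookup F (p, q) * \<iota> p q k e)"

text \<open>Coefficient of the \<open>k\<close>-th power after specialising \<open>w\<^sup>1\<^sup>/\<^sup>T\<close> to the number \<open>\<rho>\<close>.\<close>

definition expand_at ::
    "nat \<Rightarrow> complex \<Rightarrow> (rat \<Rightarrow> rat \<Rightarrow> rat \<Rightarrow> rat \<Rightarrow> complex) \<Rightarrow> (rat \<times> rat \<Rightarrow>\<^sub>0 complex) \<Rightarrow> rat \<Rightarrow> complex"
  where
  "expand_at T \<rho> \<iota> F k = Sum_any (\<lambda>e. expand \<iota> F k e * \<rho> powi \<lfloor>of_nat T * e\<rfloor>)"


section \<open>Twisted intertwining operators\<close>

text \<open>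
  \<^term>\<open>I v n\<close> is the coefficient of \<open>w\<^sup>-\<^sup>n\<^sup>-\<^sup>h\<^sup>-\<^sup>1\<close> in \<open>I(v,w)\<close>. The twisted Jacobi identity is the equality,
  for every \<open>m\<close>, of the coefficients of \<open>w\<^sup>-\<^sup>m\<^sup>-\<^sup>h\<^sup>-\<^sup>1\<close> of its two sides; all sums have finite support
  by truncation. The last conjunct is \<open>I(L\<^sub>-\<^sub>1v,w) = \<partial>\<^sub>wI(v,w)\<close>, with \<open>L\<^sub>-\<^sub>1\<close> the zeroth mode of
  the conformal vector.
\<close>

definition twisted_intertwining_operators ::
    "'v::complex_vec voa \<Rightarrow> ('v \<Rightarrow> 'v) \<Rightarrow> int \<Rightarrow> complex \<Rightarrow> complex \<Rightarrow>
     ('v, 'm3::complex_vec) tmod \<Rightarrow> ('v, 'm1::complex_vec) tmod \<Rightarrow> ('v, 'm2::complex_vec) tmod \<Rightarrow>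
     ('m1 \<Rightarrow> rat \<Rightarrow> 'm2 \<Rightarrow> 'm3) set" where
  "twisted_intertwining_operators V g2 \<epsilon> \<zeta> h M3 M1 M2 = {I. let T = fun_order g2 in
     (\<forall>n u. clinear (\<lambda>v. I v n u)) \<and> (\<forall>v n. clinear (I v n)) \<and>
     (\<forall>v n. of_nat T * n \<notin> \<int> \<longrightarrow> I v n = 0) \<and>
     (\<forall>v u. \<exists>N. \<forall>n\<ge>N. I v n u = 0) \<and>
     (\<forall>r<T. \<forall>a \<in> eigenspace g2 r. \<forall>F \<in> twisted_laurent T \<epsilon> r. \<forall>v u m.
        Sum_any (\<lambda>(k, e). expand mono_inf F k e *\<^sub>C tmode M3 a k (I v (m + e) u))
        - Sum_any (\<lambda>(k, e). expand (mono_zero T \<zeta>) F k e *\<^sub>C I v (m + e) (tmode M2 a k u))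
        = Sum_any (\<lambda>(k, e). expand mono_w F k e *\<^sub>C I (tmode M1 a k v) (m + e) u)) \<and>
     (\<forall>v n u. I (tmode M1 (conformal V) 0 v) n u = - ((of_rat n + h) *\<^sub>C I v (n - 1) u))}"


section \<open>Twisted conformal blocks\<close>

text \<open>
  Actions at \<open>0\<close>, \<open>w\<close> and \<open>\<infinity>\<close> of the class of \<open>a \<otimes> f dz\<close>, where \<open>f\<close> is given by the coefficients
  of its expansion at the point in question. At \<open>\<infinity>\<close> the residue is a sum with infinitely many
  terms on the module, so it is paired with a functional from the contragredient term by term.
\<close>

definition act_local :: "('v, 'm::complex_vec) tmod \<Rightarrow> 'v \<Rightarrow> (rat \<Rightarrow> complex) \<Rightarrow> 'm \<Rightarrow> 'm" where
  "act_local M a f u = Sum_any (\<lambda>k. f k *\<^sub>C tmode M a k u)"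

definition act_inf ::
    "('v, 'm::complex_vec) tmod \<Rightarrow> 'v \<Rightarrow> (rat \<Rightarrow> complex) \<Rightarrow> ('m \<Rightarrow> complex) \<Rightarrow> 'm \<Rightarrow> complex" where
  "act_inf M a f \<psi> u = - Sum_any (\<lambda>k. f k * \<psi> (tmode M a k u))"

text \<open>
  The image of the twisted chiral Lie algebra acting on the tensor product. The Lie algebra is
  spanned by the classes of the \<open>a \<otimes> f dz\<close> and acts through representatives, hence the image is the span of
  the vectors below. Here \<open>\<rho> = w\<^sup>1\<^sup>/\<^sup>T\<close> and \<open>(-w)\<^sup>1\<^sup>/\<^sup>T = \<zeta> \<rho>\<close>.
\<close>

definition chiral_image ::
    "'v::complex_vec voa \<Rightarrow> ('v \<Rightarrow> 'v) \<Rightarrow> int \<Rightarrow> complex \<Rightarrow> complex \<Rightarrow>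
     ('v, 'm3::complex_vec) tmod \<Rightarrow> ('v, 'm1::complex_vec) tmod \<Rightarrow> ('v, 'm2::complex_vec) tmod \<Rightarrow>
     ((('m3 \<Rightarrow> complex) \<Rightarrow> 'm1 \<Rightarrow> 'm2 \<Rightarrow> complex) \<Rightarrow> complex) set" where
  "chiral_image V g2 \<epsilon> \<zeta> \<rho> M3 M1 M2 = (let T = fun_order g2; D = contragredient_space M3 in
     cvec.span
       {pure_tensor D (act_inf M3 a (expand_at T \<rho> mono_inf F) \<psi>) v u
        + pure_tensor D \<psi> (act_local M1 a (expand_at T \<rho> mono_w F) v) u
        + pure_tensor D \<psi> v (act_local M2 a (expand_at T \<rho> (mono_zero T \<zeta>) F) u)
        | a r j F \<psi> v u.
          r < T \<and> a \<in> eigenspace g2 r \<and> a \<in> wt_space V j \<and> F \<in> twisted_laurent T \<epsilon> r \<and> \<psi> \<in> D})"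

text \<open>Linear functionals on the tensor product are represented by functions that are zero off it.\<close>

definition twisted_conformal_blocks ::
    "'v::complex_vec voa \<Rightarrow> ('v \<Rightarrow> 'v) \<Rightarrow> int \<Rightarrow> complex \<Rightarrow> complex \<Rightarrow>
     ('v, 'm3::complex_vec) tmod \<Rightarrow> ('v, 'm1::complex_vec) tmod \<Rightarrow> ('v, 'm2::complex_vec) tmod \<Rightarrow>
     (((('m3 \<Rightarrow> complex) \<Rightarrow> 'm1 \<Rightarrow> 'm2 \<Rightarrow> complex) \<Rightarrow> complex) \<Rightarrow> complex) set" where
  "twisted_conformal_blocks V g2 \<epsilon> \<zeta> \<rho> M3 M1 M2 =
     {\<phi>. clinear_on (tensor_space (contragredient_space M3)) \<phi> \<and>
         (\<forall>x. x \<notin> tensor_space (contragredient_space M3) \<longrightarrow> \<phi> x = 0) \<and>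
         (\<forall>x \<in> chiral_image V g2 \<epsilon> \<zeta> \<rho> M3 M1 M2. \<phi> x = 0)}"

end

theory Submission
  imports Defs
begin

text \<open>
  Specialising \<open>w\<^sup>1\<^sup>/\<^sup>T\<close> to \<open>\<rho>\<close> and dropping the constant \<open>w\<^sup>-\<^sup>h\<close>, an intertwining operator \<open>I\<close> gives the
  trilinear form \<open>\<beta>(\<psi>,v,u) = \<psi>(I(v,w)u)\<close>. For homogeneous arguments the grading by \<open>L\<^sub>0\<close> leaves a single
  term of this sum, that of the mode \<open>n = deg v + deg u - deg \<psi> - 1\<close>. Hence \<open>\<beta>\<close> determines all matrix
  coefficients \<open>\<psi>(v\<^sub>(\<^sub>n\<^sub>)u)\<close>, and as the graded pieces of \<open>M\<^sup>3\<close> are finite dimensional, every form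
  arises from modes in this way.

  The Jacobi identity and the invariance of a block are linear in \<open>F\<close>, so that only the monomials
  \<open>z\<^sup>p(z-w)\<^sup>q\<close> matter. Paired with a homogeneous \<open>\<psi>\<close>, the Jacobi identity for a monomial is trivial in all
  degrees in \<open>w\<close> except one, where it is a nonzero multiple of the invariance of \<open>\<beta>\<close>. The identity
  \<open>I(L\<^sub>-\<^sub>1v,w) = \<partial>\<^sub>wI(v,w)\<close> costs nothing: given the Jacobi identity for \<open>\<omega>\<close> and \<open>F = z\<close>, it says that the modes
  are homogeneous of the expected degree.
\<close>

section \<open>Linear maps and finitely supported sums\<close>

text \<open>A form provides, for fixed v and u, only a functional on the dual of each graded piece
  of M^3. Passing to modes thus means recovering a vector from the bidual, and this is where finite
  dimension enters. In the opposite direction the sum defining the form must be finite, which rests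
  on homogeneity of the modes. There the shift h = h_1 + h_2 - h_3 is decisive: it turns the
  L_0-eigenvalue of v_(n)u into one that occurs on M^3. For complex h no value of w^(-h) is
  distinguished, and any choice would only rescale the isomorphism by a nonzero constant, so the
  factor can be left out. Two mismatches shape the rest. Invariance is given for homogeneous a, the
  Jacobi identity is demanded on whole eigenspaces of g_2; the gap closes because g_2 fixes the
  conformal vector and so commutes with L_0. And powers of \<open>\<rho>\<close> are multiplicative
  only for exponents in (1/T)Z, so integrality of exponents has to be tracked.\<close>

lemma clinear_iff:
  "clinear f \<longleftrightarrow> (\<forall>x y. f (x + y) = f x + f y) \<and> (\<forall>c x. f (c *\<^sub>C x) = c *\<^sub>C f x)"
  by (auto simp: Vector_Spaces.linear_iff cvec.vector_space_axioms)

lemma clinear_add: "clinear f \<Longrightarrow> f (x + y) = f x + f y"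
  and clinear_scale: "clinear f \<Longrightarrow> f (c *\<^sub>C x) = c *\<^sub>C f x"
  by (auto simp: clinear_iff)

lemma clinear_zero: "clinear f \<Longrightarrow> f 0 = 0"
  using clinear_add[of f 0 0] by simp

lemma clinear_minus: "clinear f \<Longrightarrow> f (- x) = - f x"
  using clinear_add[of f x "- x"] clinear_zero[of f] by (simp add: eq_neg_iff_add_eq_0 add.commute)

lemma clinear_diff: "clinear f \<Longrightarrow> f (x - y) = f x - f y"
  using clinear_add[of f x "- y"] clinear_minus[of f y] by simp

lemma clinear_sum: "clinear f \<Longrightarrow> f (sum g A) = (\<Sum>x\<in>A. f (g x))"
  by (induction A rule: infinite_finite_induct) (auto simp: clinear_zero clinear_add)

lemma clinear_Sum_any:
  assumes "clinear f" "finite {i. g i \<noteq> 0}"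
  shows "f (Sum_any g) = Sum_any (\<lambda>i. f (g i))"
proof -
  have "{i. f (g i) \<noteq> 0} \<subseteq> {i. g i \<noteq> 0}" using clinear_zero[OF assms(1)] by auto
  then have "Sum_any (\<lambda>i. f (g i)) = (\<Sum>i | g i \<noteq> 0. f (g i))"
    by (rule Sum_any.expand_superset[OF assms(2)])
  then show ?thesis by (simp add: Sum_any.expand_set clinear_sum[OF assms(1)])
qed

text \<open>A nonzero scalar does not change the support; if the support is infinite, both sides
  take the default value 0. Hence there is no finiteness hypothesis.\<close>

lemma scaleC_Sum_any: "c *\<^sub>C Sum_any g = Sum_any (\<lambda>i. c *\<^sub>C g i)"
proof (cases "c = 0")
  case False
  then have "{i. c *\<^sub>C g i \<noteq> 0} = {i. g i \<noteq> 0}" by simp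
  then show ?thesis by (simp add: Sum_any.expand_set cvec.scale_sum_right)
qed simp

lemma mult_Sum_any: "c * Sum_any g = Sum_any (\<lambda>i. c * g i)" for c :: complex
  using scaleC_Sum_any[of c g] by (simp add: scaleC_complex_def)

lemma Sum_any_sum_swap:
  assumes "finite A" "\<And>x. x \<in> A \<Longrightarrow> finite {y. g x y \<noteq> 0}"
  shows "Sum_any (\<lambda>y. \<Sum>x\<in>A. g x y) = (\<Sum>x\<in>A. Sum_any (g x))"
  using assms
proof (induction A)
  case (insert a A)
  have "finite {y. (\<Sum>x\<in>A. g x y) \<noteq> 0}"
  proof (rule finite_subset)
    show "{y. (\<Sum>x\<in>A. g x y) \<noteq> 0} \<subseteq> (\<Union>x\<in>A. {y. g x y \<noteq> 0})"
    proof
      fix y assume "y \<in> {y. (\<Sum>x\<in>A. g x y) \<noteq> 0}"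
      then obtain x where "x \<in> A" "g x y \<noteq> 0"
        using sum.not_neutral_contains_not_neutral[of "\<lambda>x. g x y" A] by auto
      then show "y \<in> (\<Union>x\<in>A. {y. g x y \<noteq> 0})" by auto
    qed
  qed (use insert in auto)
  with insert show ?case by (simp add: Sum_any.distrib)
qed simp

text \<open>The two supports are in bijection, so they are finite or infinite together, and in the
  infinite case both sums are 0 by default.\<close>

lemma Sum_any_inj_reindex:
  assumes "inj f" "\<And>x. x \<notin> range f \<Longrightarrow> g x = 0"
  shows "Sum_any g = Sum_any (\<lambda>l. g (f l))"
proof -
  have "x \<in> f ` {l. g (f l) \<noteq> 0}" if "g x \<noteq> 0" for x
  proof -
    have "x \<in> range f" using assms(2)[of x] that by argo
    then show ?thesis using that by auto
  qed
  then have "{x. g x \<noteq> 0} = f ` {l. g (f l) \<noteq> 0}" by auto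
  moreover have "inj_on f {l. g (f l) \<noteq> 0}" using assms(1) by (rule inj_on_subset) simp
  ultimately show ?thesis by (simp add: Sum_any.expand_set sum.reindex)
qed

lemma Sum_any_single: "(\<And>i. i \<noteq> a \<Longrightarrow> g i = 0) \<Longrightarrow> Sum_any g = g a"
  using Sum_any.expand_superset[of "{a}" g] by fastforce

lemma finite_nonzero_add:
  fixes f g :: "'i \<Rightarrow> 'a::monoid_add"
  assumes "finite {i. f i \<noteq> 0}" "finite {i. g i \<noteq> 0}"
  shows "finite {i. f i + g i \<noteq> 0}"
  by (rule finite_subset[of _ "{i. f i \<noteq> 0} \<union> {i. g i \<noteq> 0}"]) (use assms in auto)

lemma finite_nonzero_imp:
  assumes "finite {i. f i \<noteq> 0}" "\<And>i. f i = 0 \<Longrightarrow> g i = 0"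
  shows "finite {i. g i \<noteq> 0}"
  using assms by (auto elim: rev_finite_subset)

lemma finite_of_truncated:
  fixes Y :: "rat \<Rightarrow> 'a::zero"
  assumes "\<forall>n\<ge>N. Y n = 0"
  shows "finite {l::nat. Y (p + of_nat l) \<noteq> 0}"
proof (rule finite_subset)
  show "{l. Y (p + of_nat l) \<noteq> 0} \<subseteq> {..nat \<lceil>N - p\<rceil>}"
  proof
    fix l assume "l \<in> {l. Y (p + of_nat l) \<noteq> 0}"
    with assms have "\<not> p + of_nat l \<ge> N" by blast
    then have "of_nat l \<le> N - p" by simp
    then have "l \<le> nat \<lceil>N - p\<rceil>" by linarith
    then show "l \<in> {..nat \<lceil>N - p\<rceil>}" by simp
  qed
qed simp

lemma finite_of_truncated_below:
  fixes Y :: "rat \<Rightarrow> 'a::zero"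
  assumes "\<forall>n<N. Y n = 0"
  shows "finite {l::nat. Y (p - of_nat l) \<noteq> 0}"
  using finite_of_truncated[of "1 - N" "\<lambda>n. Y (- n)" "- p"] assms by (simp add: add.commute)


lemma clinear_Sum_any_fun:
  assumes "\<And>i. clinear (f i)" "finite A" "\<And>i x. i \<notin> A \<Longrightarrow> f i x = 0"
  shows "clinear (\<lambda>x. Sum_any (\<lambda>i. f i x))"
proof -
  have "Sum_any (\<lambda>i. f i x) = (\<Sum>i\<in>A. f i x)" for x
    by (rule Sum_any.expand_superset[OF assms(2)]) (use assms(3) in auto)
  then show ?thesis
    using assms(1) by (simp add: clinear_iff sum.distrib cvec.scale_sum_right)
qed

lemma sum_fun_apply: "(\<Sum>i\<in>A. f i) x = (\<Sum>i\<in>A. f i x)"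
  for f :: "'i \<Rightarrow> 'a \<Rightarrow> 'b::comm_monoid_add"
  by (induction A rule: infinite_finite_induct) auto

lemma clinear_on_zero: "clinear_on D f \<Longrightarrow> cvec.subspace D \<Longrightarrow> f 0 = 0"
  unfolding clinear_on_def by (metis cvec.scale_zero_left cvec.subspace_0)

lemma clinear_on_scale: "clinear_on D f \<Longrightarrow> x \<in> D \<Longrightarrow> f (c *\<^sub>C x) = c *\<^sub>C f x"
  and clinear_on_add: "clinear_on D f \<Longrightarrow> x \<in> D \<Longrightarrow> y \<in> D \<Longrightarrow> f (x + y) = f x + f y"
  by (simp_all add: clinear_on_def)

lemma clinear_on_minus: "clinear_on D f \<Longrightarrow> x \<in> D \<Longrightarrow> f (- x) = - f x"
  using clinear_on_scale[of D f x "- 1"] by simp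

lemma clinear_on_sum:
  assumes "clinear_on D f" "cvec.subspace D" "\<And>i. i \<in> A \<Longrightarrow> g i \<in> D"
  shows "f (sum g A) = (\<Sum>i\<in>A. f (g i))"
  using assms(3)
proof (induction A rule: infinite_finite_induct)
  case (insert i A)
  have "sum g A \<in> D" by (rule cvec.subspace_sum[OF assms(2)]) (use insert in auto)
  then show ?case using insert clinear_on_add[OF assms(1), of "g i" "sum g A"] by simp
qed (simp_all add: clinear_on_zero[OF assms(1,2)])

lemma subspace_Sum_any:
  assumes "cvec.subspace D" "\<And>i. g i \<in> D"
  shows "Sum_any g \<in> D"
  unfolding Sum_any.expand_set by (rule cvec.subspace_sum) (use assms in auto)

lemma clinear_on_Sum_any:
  assumes "clinear_on D f" "cvec.subspace D" "\<And>i. g i \<in> D" "finite {i. g i \<noteq> 0}"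
  shows "f (Sum_any g) = Sum_any (\<lambda>i. f (g i))"
proof -
  have "Sum_any (\<lambda>i. f (g i)) = (\<Sum>i | g i \<noteq> 0. f (g i))"
    by (rule Sum_any.expand_superset[OF assms(4)]) (use clinear_on_zero[OF assms(1,2)] in auto)
  then show ?thesis
    unfolding Sum_any.expand_set[of g] using clinear_on_sum[OF assms(1,2), of "{i. g i \<noteq> 0}" g] assms(3)
    by simp
qed

lemma subspace_clinear_on_image:
  assumes S: "cvec.subspace S" and f: "clinear_on S f"
  shows "cvec.subspace (f ` S)"
proof (rule cvec.subspaceI)
  show "0 \<in> f ` S" using clinear_on_zero[OF f S] cvec.subspace_0[OF S] by force
next
  fix x y assume "x \<in> f ` S" "y \<in> f ` S"
  then obtain x' y' where "x' \<in> S" "y' \<in> S" "x = f x'" "y = f y'" by blast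
  then have "x + y = f (x' + y')" "x' + y' \<in> S"
    using clinear_on_add[OF f] cvec.subspace_add[OF S] by simp_all
  then show "x + y \<in> f ` S" by blast
next
  fix c x assume "x \<in> f ` S"
  then obtain x' where "x' \<in> S" "x = f x'" by blast
  then have "c *\<^sub>C x = f (c *\<^sub>C x')" "c *\<^sub>C x' \<in> S"
    using clinear_on_scale[OF f] cvec.subspace_scale[OF S] by simp_all
  then show "c *\<^sub>C x \<in> f ` S" by blast
qed


section \<open>Graded vector spaces\<close>

text \<open>The projection onto the i-th summand along the others; the description is meaningful
  because the decomposition into homogeneous parts is unique.\<close>

definition component :: "('i \<Rightarrow> 'a::complex_vec set) \<Rightarrow> 'i \<Rightarrow> 'a \<Rightarrow> 'a" where
  "component G i x = (THE f. (\<forall>i. f i \<in> G i) \<and> finite {i. f i \<noteq> 0} \<and> x = Sum_any f) i"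

context
  fixes G :: "'i \<Rightarrow> 'a::complex_vec set"
  assumes G: "direct_sum_decomposition G"
begin

lemma graded_subspace: "cvec.subspace (G i)"
  using G by (simp add: direct_sum_decomposition_def)

lemma component:
  shows component_mem: "component G i x \<in> G i"
    and finite_component: "finite {i. component G i x \<noteq> 0}"
    and Sum_any_component: "Sum_any (\<lambda>i. component G i x) = x"
proof -
  have "\<exists>!f. (\<forall>i. f i \<in> G i) \<and> finite {i. f i \<noteq> 0} \<and> x = Sum_any f"
    using G by (simp add: direct_sum_decomposition_def)
  from theI'[OF this] show "component G i x \<in> G i" "finite {i. component G i x \<noteq> 0}"
    "Sum_any (\<lambda>i. component G i x) = x"
    unfolding component_def by auto
qed

lemma component_eqI:
  assumes "\<And>i. f i \<in> G i" "finite {i. f i \<noteq> 0}" "Sum_any f = x"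
  shows "component G i x = f i"
proof -
  have "\<exists>!f. (\<forall>i. f i \<in> G i) \<and> finite {i. f i \<noteq> 0} \<and> x = Sum_any f"
    using G by (simp add: direct_sum_decomposition_def)
  then have "(THE f. (\<forall>i. f i \<in> G i) \<and> finite {i. f i \<noteq> 0} \<and> x = Sum_any f) = f"
    by (rule the1_equality) (use assms in simp)
  then show ?thesis by (simp add: component_def)
qed

lemma clinear_component: "clinear (component G i)"
  unfolding clinear_iff
proof (intro conjI allI)
  fix x y
  show "component G i (x + y) = component G i x + component G i y"
  proof (rule component_eqI)
    show "component G i x + component G i y \<in> G i" for i
      by (intro cvec.subspace_add graded_subspace component_mem)
    show "finite {i. component G i x + component G i y \<noteq> 0}"
      by (intro finite_nonzero_add finite_component)
    show "Sum_any (\<lambda>i. component G i x + component G i y) = x + y"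
      by (simp only: Sum_any.distrib[OF finite_component finite_component] Sum_any_component)
  qed
next
  fix c x
  show "component G i (c *\<^sub>C x) = c *\<^sub>C component G i x"
  proof (rule component_eqI)
    show "c *\<^sub>C component G i x \<in> G i" for i
      by (intro cvec.subspace_scale graded_subspace component_mem)
    show "finite {i. c *\<^sub>C component G i x \<noteq> 0}"
      by (rule finite_nonzero_imp[OF finite_component[of x]]) simp
    show "Sum_any (\<lambda>i. c *\<^sub>C component G i x) = c *\<^sub>C x"
      by (simp only: scaleC_Sum_any[symmetric] Sum_any_component)
  qed
qed

lemma component_homogeneous:
  assumes "x \<in> G j"
  shows "component G i x = (if i = j then x else 0)"
  by (rule component_eqI) (use assms cvec.subspace_0[OF graded_subspace] in auto)

lemma graded_induct:
  assumes "P 0" "\<And>x y. P x \<Longrightarrow> P y \<Longrightarrow> P (x + y)" "\<And>i x. x \<in> G i \<Longrightarrow> P x"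
  shows "P x"
proof -
  have "P (\<Sum>i\<in>A. component G i x)" for A
    by (induction A rule: infinite_finite_induct) (auto intro: assms component_mem)
  then show ?thesis using Sum_any_component[of x] unfolding Sum_any.expand_set by metis
qed

text \<open>The projections commute with L, so the j-th component of x is multiplied both by
  \<open>lam j\<close> and by \<open>lam i\<close>; distinct eigenvalues force it to vanish for j
  \<noteq> i. Applied to L_0, this turns eigenvalue computations into statements about
  degrees.\<close>

lemma eigenvector_mem:
  assumes L: "clinear L" and eig: "\<And>i x. x \<in> G i \<Longrightarrow> L x = lam i *\<^sub>C x"
    and inj: "inj lam" and x: "L x = lam i *\<^sub>C x"
  shows "x \<in> G i"
proof -
  have comp: "component G j (L y) = lam j *\<^sub>C component G j y" for j y
  proof (induction y rule: graded_induct)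
    case 1
    then show ?case by (simp add: clinear_zero[OF L] clinear_zero[OF clinear_component])
  next
    case (2 y z)
    then show ?case
      by (simp add: clinear_add[OF L] clinear_add[OF clinear_component] scaleC_add_right)
  next
    case (3 k y)
    then show ?case
      by (simp add: eig clinear_scale[OF clinear_component] component_homogeneous)
  qed
  have "component G j x = 0" if "j \<noteq> i" for j
  proof -
    have "lam j *\<^sub>C component G j x = lam i *\<^sub>C component G j x"
      using comp[of j x] x clinear_scale[OF clinear_component] by metis
    moreover have "lam j \<noteq> lam i" using that inj by (auto dest: injD)
    ultimately show ?thesis by simp
  qed
  then have "x = component G i x"
    using Sum_any_single[of i "\<lambda>j. component G j x"] Sum_any_component[of x] by metis
  then show ?thesis using component_mem[of i x] by simp
qed

end

lemma graded_induct_degrees: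
  assumes G: "direct_sum_decomposition G" and z: "\<And>i. \<not> D i \<Longrightarrow> G i = {0}"
    and "P 0" "\<And>x y. P x \<Longrightarrow> P y \<Longrightarrow> P (x + y)" "\<And>i x. D i \<Longrightarrow> x \<in> G i \<Longrightarrow> P x"
  shows "P x"
proof (rule graded_induct[OF G])
  fix i x assume "x \<in> G i"
  then show "P x" using z[of i] assms(3,5) by (cases "D i") auto
qed (use assms in blast)+

text \<open>In contrast to a sum over a fixed finite index set, the set of indices that contribute
  here depends on x; it is finite because x has finitely many components.\<close>

lemma clinear_Sum_any_component:
  assumes G: "direct_sum_decomposition G" and h: "\<And>i. clinear (h i)"
  shows "clinear (\<lambda>x. Sum_any (\<lambda>i. h i (component G i x)))"
proof -
  have fin: "finite {i. h i (component G i x) \<noteq> 0}" for x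
    by (rule finite_nonzero_imp[OF finite_component[OF G, of x]]) (simp add: clinear_zero[OF h])
  show ?thesis
    unfolding clinear_iff
    by (simp add: clinear_add[OF clinear_component[OF G]] clinear_scale[OF clinear_component[OF G]]
        clinear_add[OF h] clinear_scale[OF h] Sum_any.distrib fin scaleC_Sum_any)
qed

section \<open>Expansions\<close>

text \<open>The number w^e when w^(1/T) is taken to be \<open>\<rho>\<close>. The floor is harmless
  for e in (1/T)Z and gives a default integer exponent otherwise.\<close>

definition root_power :: "nat \<Rightarrow> complex \<Rightarrow> rat \<Rightarrow> complex" where
  "root_power T \<rho> e = \<rho> powi \<lfloor>of_nat T * e\<rfloor>"

lemma root_power_nonzero: "\<rho> \<noteq> 0 \<Longrightarrow> root_power T \<rho> e \<noteq> 0"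
  by (simp add: root_power_def)

lemma root_power_add:
  assumes "\<rho> \<noteq> 0" "of_nat T * x \<in> \<int>" "of_nat T * y \<in> \<int>"
  shows "root_power T \<rho> (x + y) = root_power T \<rho> x * root_power T \<rho> y"
  using assms by (auto elim!: Ints_cases simp: root_power_def distrib_left power_int_add)

section \<open>A uniform treatment of the three expansions of a monomial\<close>

context
  fixes \<iota> :: "rat \<Rightarrow> rat \<Rightarrow> rat \<Rightarrow> rat \<Rightarrow> complex"
    and c :: "rat \<Rightarrow> rat \<Rightarrow> nat \<Rightarrow> complex"
    and \<kappa> \<eta> :: "rat \<Rightarrow> rat \<Rightarrow> nat \<Rightarrow> rat"
  assumes \<iota>: "\<And>p q k e. \<iota> p q k e = (\<Sum>l | k = \<kappa> p q l \<and> e = \<eta> p q l. c p q l)"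
    and inj: "\<And>p q. inj (\<kappa> p q)"
begin

lemma monomial_coeff:
  "\<iota> p q (\<kappa> p q l) e = (if e = \<eta> p q l then c p q l else 0)"
proof -
  have "{l'. \<kappa> p q l = \<kappa> p q l' \<and> e = \<eta> p q l'} = (if e = \<eta> p q l then {l} else {})"
    using inj[of p q] by (auto dest: injD)
  then show ?thesis by (simp add: \<iota>)
qed

lemma monomial_coeff_outside: "k \<notin> range (\<kappa> p q) \<Longrightarrow> \<iota> p q k e = 0"
proof -
  assume "k \<notin> range (\<kappa> p q)"
  then have "{l. k = \<kappa> p q l \<and> e = \<eta> p q l} = {}" by auto
  then show ?thesis by (simp only: \<iota> sum.empty)
qed

text \<open>For one monomial the pairs (k, e) run through a single sequence indexed by l, without
  repetition since \<open>\<kappa>\<close> is injective. The double sum therefore collapses to a sum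
  over l, and finiteness along each sequence permits the exchange with the finite sum over the
  monomials of F.\<close>

lemma Sum_any_expand:
  assumes fin: "\<And>p q. finite {l. X (\<kappa> p q l) (\<eta> p q l) \<noteq> 0}"
  shows "Sum_any (\<lambda>(k, e). expand \<iota> F k e *\<^sub>C X k e) =
    (\<Sum>(p, q)\<in>Poly_Mapping.keys F. Poly_Mapping.lookup F (p, q) *\<^sub>C
       Sum_any (\<lambda>l. c p q l *\<^sub>C X (\<kappa> p q l) (\<eta> p q l)))"
proof -
  define g where "g = (\<lambda>(p, q) (k, e). Poly_Mapping.lookup F (p, q) *\<^sub>C \<iota> p q k e *\<^sub>C X k e)"
  define f where "f = (\<lambda>p q l. (\<kappa> p q l, \<eta> p q l))"
  have inj_f: "inj (f p q)" for p q
    using inj[of p q] by (auto simp: f_def inj_on_def)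
  have outside: "g (p, q) y = 0" if "y \<notin> range (f p q)" for p q y
  proof (cases y)
    case (Pair k e)
    have "{l. k = \<kappa> p q l \<and> e = \<eta> p q l} = {}" using that Pair by (auto simp: f_def)
    then have "\<iota> p q k e = 0" by (simp only: \<iota> sum.empty)
    then show ?thesis by (simp add: g_def Pair)
  qed
  have inside: "g (p, q) (f p q l) =
      Poly_Mapping.lookup F (p, q) *\<^sub>C c p q l *\<^sub>C X (\<kappa> p q l) (\<eta> p q l)" for p q l
    by (simp add: g_def f_def monomial_coeff)
  have fin_g: "finite {y. g (p, q) y \<noteq> 0}" for p q
  proof (rule finite_subset)
    show "{y. g (p, q) y \<noteq> 0} \<subseteq> f p q ` {l. X (\<kappa> p q l) (\<eta> p q l) \<noteq> 0}"
    proof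
      fix y assume y: "y \<in> {y. g (p, q) y \<noteq> 0}"
      then obtain l where l: "y = f p q l" using outside[of y p q] by auto
      with y show "y \<in> f p q ` {l. X (\<kappa> p q l) (\<eta> p q l) \<noteq> 0}" by (auto simp: inside)
    qed
  qed (use fin in simp)
  have "(\<lambda>(k, e). expand \<iota> F k e *\<^sub>C X k e) = (\<lambda>y. \<Sum>x\<in>Poly_Mapping.keys F. g x y)"
    by (auto simp: fun_eq_iff expand_def cvec.scale_sum_left g_def scaleC_scaleC
        intro!: sum.cong)
  then have "Sum_any (\<lambda>(k, e). expand \<iota> F k e *\<^sub>C X k e) =
      (\<Sum>x\<in>Poly_Mapping.keys F. Sum_any (g x))"
    using Sum_any_sum_swap[of "Poly_Mapping.keys F" g] fin_g by auto
  also have "\<dots> = (\<Sum>(p, q)\<in>Poly_Mapping.keys F. Poly_Mapping.lookup F (p, q) *\<^sub>C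
       Sum_any (\<lambda>l. c p q l *\<^sub>C X (\<kappa> p q l) (\<eta> p q l)))"
    by (intro sum.cong refl)
       (auto simp: Sum_any_inj_reindex[OF inj_f outside] inside scaleC_Sum_any)
  finally show ?thesis .
qed

text \<open>After specialising w the sum over e is taken first, for each fixed k. Since k determines
  l, and l determines e, a monomial contributes at most one term to this inner sum.\<close>

lemma Sum_any_expand_at:
  assumes fin: "\<And>p q. finite {l. Y (\<kappa> p q l) \<noteq> 0}"
  shows "Sum_any (\<lambda>k. expand_at T \<rho> \<iota> F k *\<^sub>C Y k) =
    (\<Sum>(p, q)\<in>Poly_Mapping.keys F. Poly_Mapping.lookup F (p, q) *\<^sub>C
       Sum_any (\<lambda>l. (c p q l * root_power T \<rho> (\<eta> p q l)) *\<^sub>C Y (\<kappa> p q l)))"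
proof -
  define cf where "cf = (\<lambda>p q k. Sum_any (\<lambda>e. \<iota> p q k e * root_power T \<rho> e))"
  have outside: "cf p q k = 0" if "k \<notin> range (\<kappa> p q)" for p q k
    using monomial_coeff_outside[OF that] by (simp add: cf_def)
  have inside: "cf p q (\<kappa> p q l) = c p q l * root_power T \<rho> (\<eta> p q l)" for p q l
    unfolding cf_def by (subst Sum_any_single[of "\<eta> p q l"]) (auto simp: monomial_coeff)
  have fin_e: "finite {e. \<iota> p q k e \<noteq> 0}" for p q k
  proof (cases "k \<in> range (\<kappa> p q)")
    case True
    then obtain l where "k = \<kappa> p q l" by auto
    then show ?thesis
      by (intro finite_subset[of "{e. \<iota> p q k e \<noteq> 0}" "{\<eta> p q l}"]) (auto simp: monomial_coeff)
  qed (simp add: monomial_coeff_outside)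
  have cf: "expand_at T \<rho> \<iota> F k =
      (\<Sum>(p, q)\<in>Poly_Mapping.keys F. Poly_Mapping.lookup F (p, q) * cf p q k)" for k
  proof -
    define g where "g = (\<lambda>(p, q) e. Poly_Mapping.lookup F (p, q) * (\<iota> p q k e * root_power T \<rho> e))"
    have "finite {e. g x e \<noteq> 0}" for x
      by (rule finite_nonzero_imp[OF fin_e[of "fst x" "snd x" k]]) (simp add: g_def split_beta)
    then have "Sum_any (\<lambda>e. \<Sum>x\<in>Poly_Mapping.keys F. g x e) =
        (\<Sum>x\<in>Poly_Mapping.keys F. Sum_any (g x))"
      by (intro Sum_any_sum_swap) auto
    moreover have "expand_at T \<rho> \<iota> F k = Sum_any (\<lambda>e. \<Sum>x\<in>Poly_Mapping.keys F. g x e)"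
      by (auto simp: expand_at_def expand_def sum_distrib_right g_def root_power_def mult.assoc
          intro!: Sum_any.cong sum.cong)
    ultimately show ?thesis
      by (auto simp: g_def cf_def mult_Sum_any intro!: sum.cong)
  qed
  define g where "g = (\<lambda>(p, q) k. Poly_Mapping.lookup F (p, q) *\<^sub>C cf p q k *\<^sub>C Y k)"
  have outside_g: "g (p, q) k = 0" if "k \<notin> range (\<kappa> p q)" for p q k
    by (simp add: g_def outside[OF that])
  have fin_g: "finite {k. g (p, q) k \<noteq> 0}" for p q
  proof (rule finite_subset)
    show "{k. g (p, q) k \<noteq> 0} \<subseteq> \<kappa> p q ` {l. Y (\<kappa> p q l) \<noteq> 0}"
    proof
      fix k assume k: "k \<in> {k. g (p, q) k \<noteq> 0}"
      then obtain l where l: "k = \<kappa> p q l" using outside_g[of k p q] by auto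
      with k show "k \<in> \<kappa> p q ` {l. Y (\<kappa> p q l) \<noteq> 0}" by (auto simp: g_def)
    qed
  qed (use fin in simp)
  have eq: "(\<lambda>k. expand_at T \<rho> \<iota> F k *\<^sub>C Y k) = (\<lambda>k. \<Sum>x\<in>Poly_Mapping.keys F. g x k)"
    by (auto simp: fun_eq_iff cf cvec.scale_sum_left g_def scaleC_scaleC intro!: sum.cong)
  have "Sum_any (\<lambda>k. expand_at T \<rho> \<iota> F k *\<^sub>C Y k) =
      (\<Sum>x\<in>Poly_Mapping.keys F. Sum_any (g x))"
    unfolding eq by (rule Sum_any_sum_swap) (use fin_g in auto)
  also have "\<dots> = (\<Sum>(p, q)\<in>Poly_Mapping.keys F. Poly_Mapping.lookup F (p, q) *\<^sub>C
       Sum_any (\<lambda>l. (c p q l * root_power T \<rho> (\<eta> p q l)) *\<^sub>C Y (\<kappa> p q l)))"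
  proof (intro sum.cong refl, clarify)
    fix p q
    have "Sum_any (g (p, q)) = Sum_any (\<lambda>l. g (p, q) (\<kappa> p q l))"
      by (rule Sum_any_inj_reindex[OF inj outside_g])
    then show "Sum_any (g (p, q)) = Poly_Mapping.lookup F (p, q) *\<^sub>C
       Sum_any (\<lambda>l. (c p q l * root_power T \<rho> (\<eta> p q l)) *\<^sub>C Y (\<kappa> p q l))"
      by (simp add: g_def inside scaleC_Sum_any)
  qed
  finally show ?thesis .
qed

end

definition coeff_inf :: "rat \<Rightarrow> nat \<Rightarrow> complex" where
  "coeff_inf q l = (of_rat q gchoose l) * (-1) ^ l"

definition coeff_zero :: "nat \<Rightarrow> complex \<Rightarrow> rat \<Rightarrow> nat \<Rightarrow> complex" where
  "coeff_zero T \<zeta> q l = (of_rat q gchoose l) * \<zeta> powi \<lfloor>of_nat T * (q - of_nat l)\<rfloor>"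

definition coeff_w :: "rat \<Rightarrow> nat \<Rightarrow> complex" where
  "coeff_w p l = of_rat p gchoose l"

lemma mono_inf_alt:
  "mono_inf p q k e = (\<Sum>l | k = p + q - of_nat l \<and> e = of_nat l. coeff_inf q l)"
  by (simp add: mono_inf_def coeff_inf_def)

lemma mono_zero_alt:
  "mono_zero T \<zeta> p q k e = (\<Sum>l | k = p + of_nat l \<and> e = q - of_nat l. coeff_zero T \<zeta> q l)"
  by (simp add: mono_zero_def coeff_zero_def)

lemma mono_w_alt:
  "mono_w p q k e = (\<Sum>l | k = q + of_nat l \<and> e = p - of_nat l. coeff_w p l)"
  by (simp add: mono_w_def coeff_w_def)

lemma inj_add_of_nat: "inj (\<lambda>l::nat. a + of_nat l :: rat)"
  and inj_diff_of_nat: "inj (\<lambda>l::nat. a - of_nat l :: rat)"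
  by (auto simp: inj_on_def)

lemmas Sum_any_expand_inf =
  Sum_any_expand[where \<iota> = "mono_inf" and c = "\<lambda>p q. coeff_inf q" and
    \<kappa> = "\<lambda>p q l. p + q - of_nat l" and \<eta> = "\<lambda>p q l. of_nat l", OF mono_inf_alt inj_diff_of_nat]
lemmas Sum_any_expand_zero =
  Sum_any_expand[where \<iota> = "mono_zero T0 \<zeta>" and c = "\<lambda>p q. coeff_zero T0 \<zeta> q" and
    \<kappa> = "\<lambda>p q l. p + of_nat l" and \<eta> = "\<lambda>p q l. q - of_nat l", OF mono_zero_alt inj_add_of_nat] for T0 \<zeta>
lemmas Sum_any_expand_w =
  Sum_any_expand[where \<iota> = "mono_w" and c = "\<lambda>p q. coeff_w p" and
    \<kappa> = "\<lambda>p q l. q + of_nat l" and \<eta> = "\<lambda>p q l. p - of_nat l", OF mono_w_alt inj_add_of_nat]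
lemmas Sum_any_expand_at_inf =
  Sum_any_expand_at[where \<iota> = "mono_inf" and c = "\<lambda>p q. coeff_inf q" and
    \<kappa> = "\<lambda>p q l. p + q - of_nat l" and \<eta> = "\<lambda>p q l. of_nat l", OF mono_inf_alt inj_diff_of_nat]
lemmas Sum_any_expand_at_zero =
  Sum_any_expand_at[where \<iota> = "mono_zero T0 \<zeta>" and c = "\<lambda>p q. coeff_zero T0 \<zeta> q" and
    \<kappa> = "\<lambda>p q l. p + of_nat l" and \<eta> = "\<lambda>p q l. q - of_nat l", OF mono_zero_alt inj_add_of_nat] for T0 \<zeta>
lemmas Sum_any_expand_at_w =
  Sum_any_expand_at[where \<iota> = "mono_w" and c = "\<lambda>p q. coeff_w p" and
    \<kappa> = "\<lambda>p q l. q + of_nat l" and \<eta> = "\<lambda>p q l. p - of_nat l", OF mono_w_alt inj_add_of_nat]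

section \<open>Graded modules and their duals\<close>

text \<open>T is any multiple of the order of the twisting automorphism, so that one denominator
  serves all three modules; for g_1 = id the order itself would be 1.\<close>

locale graded_module =
  fixes V :: "'v::complex_vec voa" and T :: nat and M :: "('v, 'm::complex_vec) tmod"
  assumes T_pos: "T > 0"
    and clinear_mode_left: "clinear (\<lambda>a. tmode M a n u)"
    and clinear_mode: "clinear (tmode M a n)"
    and truncated: "\<exists>N. \<forall>n\<ge>N. tmode M a n u = 0"
    and graded: "direct_sum_decomposition (tdeg M)"
    and tdeg_eq_zero: "of_nat T * n \<notin> \<nat> \<Longrightarrow> tdeg M n = {0}"
    and mode_degree: "a \<in> wt_space V k \<Longrightarrow> u \<in> tdeg M n \<Longrightarrow>
      tmode M a m u \<in> tdeg M (of_nat k - m - 1 + n)"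
begin

lemma module_induct [case_names zero add homogeneous]:
  assumes "P 0" "\<And>x y. P x \<Longrightarrow> P y \<Longrightarrow> P (x + y)"
    "\<And>n x. of_nat T * n \<in> \<nat> \<Longrightarrow> x \<in> tdeg M n \<Longrightarrow> P x"
  shows "P x"
  by (rule graded_induct_degrees[OF graded, of "\<lambda>n. of_nat T * n \<in> \<nat>"])
     (use assms tdeg_eq_zero in blast)+

lemma finite_mode: "finite {l::nat. tmode M a (p + of_nat l) u \<noteq> 0}"
  using truncated[of a u] finite_of_truncated[of _ "\<lambda>n. tmode M a n u"] by blast

lemma degree_nonneg:
  fixes n :: rat
  assumes "of_nat T * n \<in> \<nat>"
  shows "n \<ge> 0"
proof (rule ccontr)
  assume "\<not> n \<ge> 0"
  then have "of_nat T * n < 0" using T_pos by (simp add: mult_pos_neg)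
  with assms show False by (auto elim!: Nats_cases)
qed

lemma subspace_dual_deg: "cvec.subspace (dual_deg M n)"
  by (rule cvec.subspaceI)
     (auto simp: dual_deg_def clinear_iff scaleC_fun_def scaleC_complex_def algebra_simps)

lemma dual_deg_subset: "\<psi> \<in> dual_deg M n \<Longrightarrow> \<psi> \<in> contragredient_space M"
  unfolding contragredient_space_def by (rule cvec.span_base) blast

lemma subspace_contragredient: "cvec.subspace (contragredient_space M)"
  unfolding contragredient_space_def by (rule cvec.subspace_span)

lemma clinear_dual_deg: "\<psi> \<in> dual_deg M n \<Longrightarrow> clinear \<psi>"
  by (simp add: dual_deg_def)

lemma dual_deg_eq_zero_on: "\<psi> \<in> dual_deg M n \<Longrightarrow> u \<in> tdeg M k \<Longrightarrow> k \<noteq> n \<Longrightarrow> \<psi> u = 0"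
  by (simp add: dual_deg_def)

lemma dual_deg_eq_zero:
  assumes "of_nat T * n \<notin> \<nat>" "\<psi> \<in> dual_deg M n"
  shows "\<psi> = 0"
proof
  note lin = clinear_dual_deg[OF assms(2)]
  fix u
  show "\<psi> u = 0 u"
  proof (induction u rule: module_induct)
    case (homogeneous k u)
    then show ?case using assms by (auto simp: dual_deg_def)
  qed (simp_all add: clinear_zero[OF lin] clinear_add[OF lin])
qed

lemma contragredient_induct [consumes 1, case_names zero add homogeneous]:
  assumes "\<psi> \<in> contragredient_space M" "P 0"
    "\<And>x y. x \<in> contragredient_space M \<Longrightarrow> y \<in> contragredient_space M \<Longrightarrow> P x \<Longrightarrow> P y \<Longrightarrow> P (x + y)"
    "\<And>n x. of_nat T * n \<in> \<nat> \<Longrightarrow> x \<in> dual_deg M n \<Longrightarrow> P x"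
  shows "P \<psi>"
proof -
  have "\<psi> \<in> contragredient_space M \<and> P \<psi>"
    using assms(1) unfolding contragredient_space_def
  proof (induction rule: cvec.span_induct_alt)
    case base
    then show ?case using assms(2) cvec.span_zero by blast
  next
    case (step c x y)
    then obtain n where "x \<in> dual_deg M n" by blast
    then have x: "c *\<^sub>C x \<in> dual_deg M n" by (rule cvec.subspace_scale[OF subspace_dual_deg])
    then have "P (c *\<^sub>C x)"
      using assms(2,4) dual_deg_eq_zero[of n "c *\<^sub>C x"] by (cases "of_nat T * n \<in> \<nat>") auto
    have y: "y \<in> contragredient_space M" "P y"
      using step.IH unfolding contragredient_space_def by blast+
    have "c *\<^sub>C x + y \<in> contragredient_space M"
      by (intro cvec.subspace_add subspace_contragredient dual_deg_subset[OF x] y)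
    moreover have "P (c *\<^sub>C x + y)"
      by (intro assms(3) dual_deg_subset[OF x] y \<open>P (c *\<^sub>C x)\<close>)
    ultimately show ?case unfolding contragredient_space_def by blast
  qed
  then show ?thesis ..
qed

lemma clinear_contragredient: "\<psi> \<in> contragredient_space M \<Longrightarrow> clinear \<psi>"
proof (induction rule: contragredient_induct)
  case (homogeneous n x)
  then show ?case by (simp add: clinear_dual_deg)
qed (simp_all add: clinear_iff scaleC_add_right)

text \<open>A mode a_(m) shifts degrees by k - m - 1, so its transpose shifts the degree of
  functionals by the opposite amount.\<close>

lemma dual_deg_mode:
  assumes "\<psi> \<in> dual_deg M n" "a \<in> wt_space V k"
  shows "(\<lambda>u. \<psi> (tmode M a m u)) \<in> dual_deg M (n - of_nat k + m + 1)"
proof -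
  have "\<psi> (tmode M a m u) = 0" if "j \<noteq> n - of_nat k + m + 1" "u \<in> tdeg M j" for j u
  proof -
    have "of_nat k - m - 1 + j \<noteq> n" using that(1) by auto
    then show ?thesis
      using assms(1) mode_degree[OF assms(2) that(2), of m] unfolding dual_deg_def by blast
  qed
  then show ?thesis
    using clinear_dual_deg[OF assms(1)] clinear_mode[of a m] by (auto simp: dual_deg_def clinear_iff)
qed

lemma contragredient_mode:
  assumes "\<psi> \<in> contragredient_space M" "a \<in> wt_space V k"
  shows "(\<lambda>u. \<psi> (tmode M a m u)) \<in> contragredient_space M"
  using assms(1)
proof (induction rule: contragredient_induct)
  case zero
  then show ?case using cvec.subspace_0[OF subspace_contragredient] by (simp add: zero_fun_def)
next
  case (add x y)
  then show ?case
    using cvec.subspace_add[OF subspace_contragredient add.IH] by (simp add: plus_fun_def)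
next
  case (homogeneous n x)
  then show ?case using dual_deg_subset[OF dual_deg_mode[OF _ assms(2)]] by blast
qed

text \<open>For very negative m the transposed mode would lead to a negative degree, where the dual
  is zero. This is what makes the infinite expansion at \<infinity> act on a functional through
  finitely many terms.\<close>

lemma contragredient_truncated:
  assumes "\<psi> \<in> contragredient_space M" "a \<in> wt_space V k"
  shows "\<exists>N. \<forall>m<N. (\<lambda>u. \<psi> (tmode M a m u)) = 0"
  using assms(1)
proof (induction rule: contragredient_induct)
  case (add x y)
  then obtain N N' where "\<forall>m<N. (\<lambda>u. x (tmode M a m u)) = 0"
    "\<forall>m<N'. (\<lambda>u. y (tmode M a m u)) = 0" by blast
  then show ?case by (intro exI[of _ "min N N'"]) (auto simp: fun_eq_iff)
next
  case (homogeneous n x)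
  have "(\<lambda>u. x (tmode M a m u)) = 0" if "m < of_nat k - n - 1" for m
  proof -
    have "of_nat T * (n - of_nat k + m + 1) \<notin> \<nat>"
      using degree_nonneg[of "n - of_nat k + m + 1"] that by auto
    then show ?thesis
      by (rule dual_deg_eq_zero[OF _ dual_deg_mode[OF homogeneous(2) assms(2)]])
  qed
  then show ?case by blast
qed auto

lemma finite_dual_mode:
  assumes "\<psi> \<in> contragredient_space M" "a \<in> wt_space V k"
  shows "finite {l::nat. (\<lambda>u. \<psi> (tmode M a (p - of_nat l) u)) \<noteq> 0}"
  using contragredient_truncated[OF assms]
    finite_of_truncated_below[of _ "\<lambda>n. (\<lambda>u. \<psi> (tmode M a n u))"] by blast

lemma dual_deg_component:
  assumes "\<psi> \<in> dual_deg M n"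
  shows "\<psi> y = \<psi> (component (tdeg M) n y)"
proof (induction y rule: module_induct)
  case (homogeneous k u)
  then show ?case
    using assms by (auto simp: component_homogeneous[OF graded] dual_deg_def clinear_zero)
qed (use clinear_dual_deg[OF assms] clinear_component[OF graded] in \<open>simp_all add: clinear_zero clinear_add\<close>)

text \<open>A basis of M(n) and its dual basis, in a form that serves both to rebuild vectors from
  functionals and functionals from their values.\<close>

lemma dual_basis:
  assumes "cfinite_dim (tdeg M n)"
  obtains B bd where "finite B" "B \<subseteq> tdeg M n" "\<And>b. bd b \<in> dual_deg M n"
    "\<And>y. y \<in> tdeg M n \<Longrightarrow> y = (\<Sum>b\<in>B. bd b y *\<^sub>C b)"
    "\<And>\<psi>. \<psi> \<in> dual_deg M n \<Longrightarrow> \<psi> = (\<Sum>b\<in>B. \<psi> b *\<^sub>C bd b)"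
proof -
  obtain B where B: "B \<subseteq> tdeg M n" "cvec.independent B" "tdeg M n \<subseteq> cvec.span B"
    using cvec.maximal_independent_subset by blast
  obtain C where "finite C" "tdeg M n \<subseteq> cvec.span C"
    using assms unfolding cfinite_dim_def by blast
  then have finB: "finite B" using cvec.independent_span_bound[of C B] B by blast
  \<comment> \<open>Coordinates are precomposed with the projection onto degree n, so that they
    vanish on the other graded pieces. For b outside B the coordinate is 0 by default, hence
    membership in the dual holds for every b.\<close>
  define bd where "bd = (\<lambda>b y. cvec.representation B (component (tdeg M) n y) b)"
  have comp: "component (tdeg M) n y \<in> cvec.span B" for y
    using component_mem[OF graded] B(3) by blast
  have bd: "bd b \<in> dual_deg M n" for b
    using clinear_component[OF graded, of n]
    by (auto simp: dual_deg_def bd_def clinear_iff cvec.representation_add[OF B(2) comp comp]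
        cvec.representation_scale[OF B(2) comp] scaleC_complex_def cvec.representation_zero
        component_homogeneous[OF graded])
  have expand: "y = (\<Sum>b\<in>B. bd b y *\<^sub>C b)" if "y \<in> tdeg M n" for y
  proof -
    have "component (tdeg M) n y = y" using that by (simp add: component_homogeneous[OF graded])
    then show ?thesis
      using cvec.sum_representation_eq[OF B(2) _ finB order_refl, of y] that B(3)
      by (auto simp: bd_def)
  qed
  have "\<psi> = (\<Sum>b\<in>B. \<psi> b *\<^sub>C bd b)" if \<psi>: "\<psi> \<in> dual_deg M n" for \<psi>
  proof
    fix y
    let ?y = "component (tdeg M) n y"
    note lin = clinear_dual_deg[OF \<psi>]
    have "\<psi> y = \<psi> (\<Sum>b\<in>B. bd b ?y *\<^sub>C b)"
      using dual_deg_component[OF \<psi>, of y] expand[OF component_mem[OF graded, of n y]] by simp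
    also have "\<dots> = (\<Sum>b\<in>B. bd b y *\<^sub>C \<psi> b)"
      by (simp add: clinear_sum[OF lin] clinear_scale[OF lin] dual_deg_component[OF bd, symmetric])
    finally show "\<psi> y = (\<Sum>b\<in>B. \<psi> b *\<^sub>C bd b) y"
      using finB by (simp add: scaleC_fun_def scaleC_complex_def mult.commute sum_fun_apply)
  qed
  then show ?thesis using that finB B(1) bd expand by blast
qed

lemma dual_separates:
  assumes fin: "\<And>n. cfinite_dim (tdeg M n)"
    and zero: "\<And>n \<psi>. of_nat T * n \<in> \<nat> \<Longrightarrow> \<psi> \<in> dual_deg M n \<Longrightarrow> \<psi> y = 0"
  shows "y = 0"
proof -
  have "component (tdeg M) n y = 0" for n
  proof -
    obtain B bd where "\<And>b. bd b \<in> dual_deg M n"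
      and y: "\<And>y. y \<in> tdeg M n \<Longrightarrow> y = (\<Sum>b\<in>B. bd b y *\<^sub>C b)"
      using dual_basis[OF fin[of n]] by metis
    then have "bd b y = 0" for b
      using zero[of n "bd b"] dual_deg_eq_zero[of n "bd b"] by (cases "of_nat T * n \<in> \<nat>") auto
    then have "bd b (component (tdeg M) n y) = 0" for b
      using dual_deg_component[OF \<open>\<And>b. bd b \<in> dual_deg M n\<close>] by metis
    then show ?thesis using y[OF component_mem[OF graded, of n y]] by simp
  qed
  then show ?thesis using Sum_any_component[OF graded, of y] by simp
qed

end

section \<open>Modes of intertwining operators and conformal blocks\<close>

locale block_setting =
  M1: graded_module V T M1 + M2: graded_module V T M2 + M3: graded_module V T M3
  for V :: "'v::complex_vec voa" and T :: nat
    and M1 :: "('v, 'm1::complex_vec) tmod"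
    and M2 :: "('v, 'm2::complex_vec) tmod"
    and M3 :: "('v, 'm3::complex_vec) tmod" +
  fixes \<rho> \<zeta> :: complex
  assumes rho: "\<rho> \<noteq> 0"
    and finite_dim: "\<And>n. cfinite_dim (tdeg M3 n)"
begin

abbreviation "D \<equiv> contragredient_space M3"
abbreviation "R \<equiv> root_power T \<rho>"

definition integral_exponent :: "rat \<Rightarrow> bool" where
  "integral_exponent x \<longleftrightarrow> of_nat T * x \<in> \<int>"

lemma integral_exponent_intros:
  "integral_exponent x \<Longrightarrow> integral_exponent y \<Longrightarrow> integral_exponent (x + y)"
  "integral_exponent x \<Longrightarrow> integral_exponent y \<Longrightarrow> integral_exponent (x - y)"
  "integral_exponent (of_nat n)" "integral_exponent 1" "integral_exponent (numeral k)"
  by (simp_all add: integral_exponent_def distrib_left right_diff_distrib)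

lemma integral_exponent_Nats: "of_nat T * x \<in> \<nat> \<Longrightarrow> integral_exponent x"
  using Nats_subset_Ints by (auto simp: integral_exponent_def)

lemma R_add: "integral_exponent x \<Longrightarrow> integral_exponent y \<Longrightarrow> R (x + y) = R x * R y"
  using root_power_add[OF rho] by (simp add: integral_exponent_def)

lemma R_nonzero: "R x \<noteq> 0"
  by (rule root_power_nonzero[OF rho])

definition bilinear_modes :: "('m1 \<Rightarrow> rat \<Rightarrow> 'm2 \<Rightarrow> 'm3) \<Rightarrow> bool" where
  "bilinear_modes I \<longleftrightarrow> (\<forall>n u. clinear (\<lambda>v. I v n u)) \<and> (\<forall>v n. clinear (I v n))"

definition truncated_modes :: "('m1 \<Rightarrow> rat \<Rightarrow> 'm2 \<Rightarrow> 'm3) \<Rightarrow> bool" where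
  "truncated_modes I \<longleftrightarrow> (\<forall>v u. \<exists>N. \<forall>n\<ge>N. I v n u = 0)"

text \<open>The coefficient of w^(-m-h-1) in left side minus right side of the Jacobi identity for F
  = z^p (z-w)^q.\<close>

definition jacobi_defect ::
    "('m1 \<Rightarrow> rat \<Rightarrow> 'm2 \<Rightarrow> 'm3) \<Rightarrow> 'v \<Rightarrow> rat \<Rightarrow> rat \<Rightarrow> 'm1 \<Rightarrow> 'm2 \<Rightarrow> rat \<Rightarrow> 'm3" where
  "jacobi_defect I a p q v u m =
     Sum_any (\<lambda>l. coeff_inf q l *\<^sub>C tmode M3 a (p + q - of_nat l) (I v (m + of_nat l) u))
     - Sum_any (\<lambda>l. coeff_zero T \<zeta> q l *\<^sub>C I v (m + (q - of_nat l)) (tmode M2 a (p + of_nat l) u))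
     - Sum_any (\<lambda>l. coeff_w p l *\<^sub>C I (tmode M1 a (q + of_nat l) v) (m + (p - of_nat l)) u)"

text \<open>The value of the form on a \<otimes> z^p (z-w)^q dz applied to a pure tensor. The term
  at \<infinity> carries the sign of the minus transpose, so all three signs are opposite to those
  of the Jacobi defect.\<close>

definition ward_defect ::
    "(('m3 \<Rightarrow> complex) \<Rightarrow> 'm1 \<Rightarrow> 'm2 \<Rightarrow> complex) \<Rightarrow> 'v \<Rightarrow> rat \<Rightarrow> rat \<Rightarrow>
     ('m3 \<Rightarrow> complex) \<Rightarrow> 'm1 \<Rightarrow> 'm2 \<Rightarrow> complex" where
  "ward_defect \<beta> a p q \<psi> v u =
     - Sum_any (\<lambda>l. coeff_inf q l * R (of_nat l) * \<beta> (\<lambda>x. \<psi> (tmode M3 a (p + q - of_nat l) x)) v u)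
     + Sum_any (\<lambda>l. coeff_w p l * R (p - of_nat l) * \<beta> \<psi> (tmode M1 a (q + of_nat l) v) u)
     + Sum_any (\<lambda>l. coeff_zero T \<zeta> q l * R (q - of_nat l) * \<beta> \<psi> v (tmode M2 a (p + of_nat l) u))"

section \<open>Finiteness and additivity of the Jacobi defect\<close>

context
  fixes I :: "'m1 \<Rightarrow> rat \<Rightarrow> 'm2 \<Rightarrow> 'm3"
  assumes bil: "bilinear_modes I"
begin

lemma clinear_modes_left: "clinear (\<lambda>v. I v n u)" and clinear_modes_right: "clinear (I v n)"
  using bil by (auto simp: bilinear_modes_def)

lemmas modes_simps = clinear_zero[OF clinear_modes_left] clinear_zero[OF clinear_modes_right]
  clinear_add[OF clinear_modes_left] clinear_add[OF clinear_modes_right]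

lemma finite_defect_zero:
  "finite {l. coeff_zero T \<zeta> q l *\<^sub>C I v (m + (q - of_nat l)) (tmode M2 a (p + of_nat l) u) \<noteq> 0}"
  by (rule finite_nonzero_imp[OF M2.finite_mode[of a p u]]) (simp add: modes_simps)

lemma finite_defect_w:
  "finite {l. coeff_w p l *\<^sub>C I (tmode M1 a (q + of_nat l) v) (m + (p - of_nat l)) u \<noteq> 0}"
  by (rule finite_nonzero_imp[OF M1.finite_mode[of a q v]]) (simp add: modes_simps)

context
  assumes trunc: "truncated_modes I"
begin

lemma finite_modes: "finite {l::nat. I v (m + of_nat l) u \<noteq> 0}"
proof -
  obtain N where "\<forall>n\<ge>N. I v n u = 0"
    using trunc unfolding truncated_modes_def by blast
  then show ?thesis by (rule finite_of_truncated[of _ "\<lambda>n. I v n u"])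
qed

text \<open>Here the modes of M^3 run towards minus infinity, where truncation in M^3 says nothing;
  finiteness comes from truncation of I. At 0 and at w it comes from truncation in M^2 and
  M^1.\<close>

lemma finite_defect_inf:
  "finite {l. coeff_inf q l *\<^sub>C tmode M3 a (p + q - of_nat l) (I v (m + of_nat l) u) \<noteq> 0}"
  by (rule finite_nonzero_imp[OF finite_modes[of v m u]]) (simp add: clinear_zero[OF M3.clinear_mode])

lemmas defect_distribs = Sum_any.distrib[OF finite_defect_inf finite_defect_inf]
  Sum_any.distrib[OF finite_defect_zero finite_defect_zero]
  Sum_any.distrib[OF finite_defect_w finite_defect_w]

lemma jacobi_expand:
  "Sum_any (\<lambda>(k, e). expand mono_inf F k e *\<^sub>C tmode M3 a k (I v (m + e) u))
   - Sum_any (\<lambda>(k, e). expand (mono_zero T \<zeta>) F k e *\<^sub>C I v (m + e) (tmode M2 a k u))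
   - Sum_any (\<lambda>(k, e). expand mono_w F k e *\<^sub>C I (tmode M1 a k v) (m + e) u) =
   (\<Sum>(p, q)\<in>Poly_Mapping.keys F. Poly_Mapping.lookup F (p, q) *\<^sub>C jacobi_defect I a p q v u m)"
proof -
  have 1: "finite {l. tmode M3 a (p + q - of_nat l) (I v (m + of_nat l) u) \<noteq> 0}" for p q
    by (rule finite_nonzero_imp[OF finite_modes[of v m u]]) (simp add: clinear_zero[OF M3.clinear_mode])
  have 2: "finite {l. I v (m + (q - of_nat l)) (tmode M2 a (p + of_nat l) u) \<noteq> 0}" for p q
    by (rule finite_nonzero_imp[OF M2.finite_mode[of a p u]]) (simp add: modes_simps)
  have 3: "finite {l. I (tmode M1 a (q + of_nat l) v) (m + (p - of_nat l)) u \<noteq> 0}" for p q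
    by (rule finite_nonzero_imp[OF M1.finite_mode[of a q v]]) (simp add: modes_simps)
  show ?thesis
    unfolding Sum_any_expand_inf[where X = "\<lambda>k e. tmode M3 a k (I v (m + e) u)", OF 1]
      Sum_any_expand_zero[where X = "\<lambda>k e. I v (m + e) (tmode M2 a k u)", OF 2]
      Sum_any_expand_w[where X = "\<lambda>k e. I (tmode M1 a k v) (m + e) u", OF 3]
    by (simp add: sum_subtractf[symmetric] jacobi_defect_def cvec.scale_right_diff_distrib split_beta)
qed

lemma jacobi_defect_add_left:
  "jacobi_defect I a p q (v + v') u m = jacobi_defect I a p q v u m + jacobi_defect I a p q v' u m"
  by (simp only: jacobi_defect_def modes_simps clinear_add[OF M3.clinear_mode] clinear_add[OF M1.clinear_mode]
      scaleC_add_right defect_distribs add_diff_add)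

lemma jacobi_defect_add_right:
  "jacobi_defect I a p q v (u + u') m = jacobi_defect I a p q v u m + jacobi_defect I a p q v u' m"
  by (simp only: jacobi_defect_def modes_simps clinear_add[OF M3.clinear_mode] clinear_add[OF M2.clinear_mode]
      scaleC_add_right defect_distribs add_diff_add)

lemma jacobi_defect_add_vector:
  "jacobi_defect I (a + b) p q v u m = jacobi_defect I a p q v u m + jacobi_defect I b p q v u m"
  by (simp only: jacobi_defect_def modes_simps clinear_add[OF M3.clinear_mode_left]
      clinear_add[OF M2.clinear_mode_left] clinear_add[OF M1.clinear_mode_left]
      scaleC_add_right defect_distribs add_diff_add)

lemma jacobi_defect_zero:
  "jacobi_defect I a p q 0 u m = 0" "jacobi_defect I a p q v 0 m = 0" "jacobi_defect I 0 p q v u m = 0"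
  using jacobi_defect_add_left[of a p q 0 0 u m] jacobi_defect_add_right[of a p q v 0 0 m]
    jacobi_defect_add_vector[of 0 0 p q v u m] by simp_all

end

end

section \<open>Finiteness and additivity of the Ward defect\<close>

context
  fixes \<beta> :: "('m3 \<Rightarrow> complex) \<Rightarrow> 'm1 \<Rightarrow> 'm2 \<Rightarrow> complex"
  assumes tri: "trilinear_on D \<beta>"
begin

lemma clinear_form1: "clinear_on D (\<lambda>\<psi>. \<beta> \<psi> v u)"
  and clinear_form2: "\<psi> \<in> D \<Longrightarrow> clinear (\<lambda>v. \<beta> \<psi> v u)"
  and clinear_form3: "\<psi> \<in> D \<Longrightarrow> clinear (\<beta> \<psi> v)"
  using tri by (auto simp: trilinear_on_def)

context
  fixes a k
  assumes a: "a \<in> wt_space V k"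
begin

lemma finite_ward_inf:
  assumes "\<psi> \<in> D"
  shows "finite {l. coeff_inf q l * R (of_nat l) * \<beta> (\<lambda>x. \<psi> (tmode M3 a (p + q - of_nat l) x)) v u \<noteq> 0}"
  by (rule finite_nonzero_imp[OF M3.finite_dual_mode[OF assms a, of "p + q"]])
     (simp add: clinear_on_zero[OF clinear_form1 M3.subspace_contragredient] del: zero_fun_def)

lemma finite_ward_w:
  assumes "\<psi> \<in> D"
  shows "finite {l. coeff_w p l * R (p - of_nat l) * \<beta> \<psi> (tmode M1 a (q + of_nat l) v) u \<noteq> 0}"
  by (rule finite_nonzero_imp[OF M1.finite_mode[of a q v]]) (simp add: clinear_zero[OF clinear_form2[OF assms]])

lemma finite_ward_zero:
  assumes "\<psi> \<in> D"
  shows "finite {l. coeff_zero T \<zeta> q l * R (q - of_nat l) * \<beta> \<psi> v (tmode M2 a (p + of_nat l) u) \<noteq> 0}"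
  by (rule finite_nonzero_imp[OF M2.finite_mode[of a p u]]) (simp add: clinear_zero[OF clinear_form3[OF assms]])

lemmas ward_distribs = Sum_any.distrib[OF finite_ward_inf finite_ward_inf]
  Sum_any.distrib[OF finite_ward_w finite_ward_w] Sum_any.distrib[OF finite_ward_zero finite_ward_zero]

lemma ward_defect_add_right:
  assumes "\<psi> \<in> D"
  shows "ward_defect \<beta> a p q \<psi> v (u + u') = ward_defect \<beta> a p q \<psi> v u + ward_defect \<beta> a p q \<psi> v u'"
  unfolding ward_defect_def clinear_add[OF clinear_form3[OF assms]]
    clinear_add[OF clinear_form3[OF M3.contragredient_mode[OF assms a]]]
    clinear_add[OF M2.clinear_mode] distrib_left
    ward_distribs[OF assms assms] by simp

lemma ward_defect_add_middle:
  assumes "\<psi> \<in> D"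
  shows "ward_defect \<beta> a p q \<psi> (v + v') u = ward_defect \<beta> a p q \<psi> v u + ward_defect \<beta> a p q \<psi> v' u"
  unfolding ward_defect_def clinear_add[OF clinear_form2[OF assms]]
    clinear_add[OF clinear_form2[OF M3.contragredient_mode[OF assms a]]]
    clinear_add[OF M1.clinear_mode] distrib_left
    ward_distribs[OF assms assms] by simp

lemma ward_defect_add_left:
  assumes "\<psi> \<in> D" "\<psi>' \<in> D"
  shows "ward_defect \<beta> a p q (\<psi> + \<psi>') v u = ward_defect \<beta> a p q \<psi> v u + ward_defect \<beta> a p q \<psi>' v u"
proof -
  have "\<beta> (\<lambda>x. (\<psi> + \<psi>') (tmode M3 a n x)) v u =
      \<beta> (\<lambda>x. \<psi> (tmode M3 a n x)) v u + \<beta> (\<lambda>x. \<psi>' (tmode M3 a n x)) v u" for n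
    using clinear_on_add[OF clinear_form1 M3.contragredient_mode[OF assms(1) a] M3.contragredient_mode[OF assms(2) a]]
    by (simp add: plus_fun_def)
  moreover have "\<beta> (\<psi> + \<psi>') v u = \<beta> \<psi> v u + \<beta> \<psi>' v u" for v u
    by (rule clinear_on_add[OF clinear_form1 assms])
  ultimately show ?thesis
    by (simp only: ward_defect_def distrib_left ward_distribs[OF assms]) simp
qed

lemma ward_defect_zero:
  "\<psi> \<in> D \<Longrightarrow> ward_defect \<beta> a p q \<psi> v 0 = 0" "\<psi> \<in> D \<Longrightarrow> ward_defect \<beta> a p q \<psi> 0 u = 0"
  "ward_defect \<beta> a p q 0 v u = 0"
  using ward_defect_add_right[of \<psi> p q v 0 0] ward_defect_add_middle[of \<psi> p q 0 0 u]
    ward_defect_add_left[of 0 0 p q v u] cvec.subspace_0[OF M3.subspace_contragredient]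
  by (simp_all del: zero_fun_def)

lemma ward_expand:
  assumes "\<psi> \<in> D"
  shows act_inf_mem: "act_inf M3 a (expand_at T \<rho> mono_inf F) \<psi> \<in> D"
    and "\<beta> (act_inf M3 a (expand_at T \<rho> mono_inf F) \<psi>) v u
       + \<beta> \<psi> (act_local M1 a (expand_at T \<rho> mono_w F) v) u
       + \<beta> \<psi> v (act_local M2 a (expand_at T \<rho> (mono_zero T \<zeta>) F) u) =
     (\<Sum>(p, q)\<in>Poly_Mapping.keys F. Poly_Mapping.lookup F (p, q) * ward_defect \<beta> a p q \<psi> v u)"
proof -
  \<comment> \<open>\<open>act_inf\<close> is defined pointwise in its last argument, while
    \<open>\<beta>\<close> is linear only on D. The action at \<infinity> is therefore first written
    as a finite combination of functionals in D, one \<open>S\<close> for each monomial.\<close>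
  define S where "S = (\<lambda>(p, q). Sum_any (\<lambda>l. (coeff_inf q l * R (of_nat l)) *\<^sub>C
      (\<lambda>x. \<psi> (tmode M3 a (p + q - of_nat l) x))))"
  have fin: "finite {l. (coeff_inf q l * R (of_nat l)) *\<^sub>C (\<lambda>x. \<psi> (tmode M3 a (p + q - of_nat l) x)) \<noteq> 0}"
    for p q
    by (rule finite_nonzero_imp[OF M3.finite_dual_mode[OF assms a, of "p + q"]]) simp
  have S_mem: "S x \<in> D" for x
    unfolding S_def split_beta
    by (intro subspace_Sum_any M3.subspace_contragredient cvec.subspace_scale M3.contragredient_mode[OF assms a])
  have act: "act_inf M3 a (expand_at T \<rho> mono_inf F) \<psi> =
      - (\<Sum>x\<in>Poly_Mapping.keys F. Poly_Mapping.lookup F x *\<^sub>C S x)"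
  proof
    fix y
    have fin_y: "finite {l. \<psi> (tmode M3 a (p + q - of_nat l) y) \<noteq> 0}" for p q
      by (rule finite_nonzero_imp[OF M3.finite_dual_mode[OF assms a, of "p + q"]]) (simp add: fun_eq_iff)
    have eval: "clinear (\<lambda>f :: 'm3 \<Rightarrow> complex. f y)"
      by (simp add: clinear_iff scaleC_fun_def)
    have "S x y = Sum_any (\<lambda>l. (coeff_inf (snd x) l * R (of_nat l)) *\<^sub>C
        \<psi> (tmode M3 a (fst x + snd x - of_nat l) y))" for x
      unfolding S_def split_beta using clinear_Sum_any[OF eval fin] by (simp add: scaleC_fun_def)
    then show "act_inf M3 a (expand_at T \<rho> mono_inf F) \<psi> y =
      (- (\<Sum>x\<in>Poly_Mapping.keys F. Poly_Mapping.lookup F x *\<^sub>C S x)) y"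
      using Sum_any_expand_at_inf[where Y = "\<lambda>k. \<psi> (tmode M3 a k y)" and T = T and \<rho> = \<rho> and F = F, OF fin_y]
      by (simp add: act_inf_def sum_fun_apply scaleC_complex_def scaleC_fun_def split_beta)
  qed
  have sum_mem: "(\<Sum>x\<in>Poly_Mapping.keys F. Poly_Mapping.lookup F x *\<^sub>C S x) \<in> D"
    by (intro cvec.subspace_sum cvec.subspace_scale M3.subspace_contragredient S_mem)
  show "act_inf M3 a (expand_at T \<rho> mono_inf F) \<psi> \<in> D"
    unfolding act by (intro cvec.subspace_neg M3.subspace_contragredient sum_mem)
  have scale_mem: "c *\<^sub>C S x \<in> D" for c x
    by (intro cvec.subspace_scale M3.subspace_contragredient S_mem)
  have \<beta>S: "\<beta> (S x) v u = Sum_any (\<lambda>l. coeff_inf (snd x) l * R (of_nat l) *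
      \<beta> (\<lambda>y. \<psi> (tmode M3 a (fst x + snd x - of_nat l) y)) v u)" for x
  proof -
    have "\<beta> (S x) v u = Sum_any (\<lambda>l. \<beta> ((coeff_inf (snd x) l * R (of_nat l)) *\<^sub>C
      (\<lambda>y. \<psi> (tmode M3 a (fst x + snd x - of_nat l) y))) v u)"
      unfolding S_def split_beta
      by (rule clinear_on_Sum_any[OF clinear_form1 M3.subspace_contragredient _ fin])
         (intro cvec.subspace_scale M3.subspace_contragredient M3.contragredient_mode[OF assms a])
    also have "\<dots> = Sum_any (\<lambda>l. coeff_inf (snd x) l * R (of_nat l) *
      \<beta> (\<lambda>y. \<psi> (tmode M3 a (fst x + snd x - of_nat l) y)) v u)"
      unfolding clinear_on_scale[OF clinear_form1 M3.contragredient_mode[OF assms a]]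
      by (simp only: scaleC_complex_def)
    finally show ?thesis .
  qed
  have 1: "\<beta> (act_inf M3 a (expand_at T \<rho> mono_inf F) \<psi>) v u =
      - (\<Sum>x\<in>Poly_Mapping.keys F. Poly_Mapping.lookup F x * \<beta> (S x) v u)"
    unfolding act clinear_on_minus[OF clinear_form1 sum_mem]
      clinear_on_sum[OF clinear_form1 M3.subspace_contragredient scale_mem]
      clinear_on_scale[OF clinear_form1 S_mem] by (simp only: scaleC_complex_def)
  note lin2 = clinear_form2[OF assms] and lin3 = clinear_form3[OF assms]
  have 2: "\<beta> \<psi> (act_local M1 a (expand_at T \<rho> mono_w F) v) u =
      (\<Sum>(p, q)\<in>Poly_Mapping.keys F. Poly_Mapping.lookup F (p, q) *
        Sum_any (\<lambda>l. coeff_w p l * R (p - of_nat l) * \<beta> \<psi> (tmode M1 a (q + of_nat l) v) u))"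
  proof -
    have "\<beta> \<psi> (Sum_any (\<lambda>l. (coeff_w p l * R (p - of_nat l)) *\<^sub>C tmode M1 a (q + of_nat l) v)) u =
      Sum_any (\<lambda>l. coeff_w p l * R (p - of_nat l) * \<beta> \<psi> (tmode M1 a (q + of_nat l) v) u)" for p q
    proof -
      have fin: "finite {l. (coeff_w p l * R (p - of_nat l)) *\<^sub>C tmode M1 a (q + of_nat l) v \<noteq> 0}"
        by (rule finite_nonzero_imp[OF M1.finite_mode[of a q v]]) simp
      show ?thesis
        unfolding clinear_Sum_any[OF lin2 fin] by (simp add: clinear_scale[OF lin2] scaleC_complex_def)
    qed
    then show ?thesis
      unfolding act_local_def Sum_any_expand_at_w[where Y = "\<lambda>k. tmode M1 a k v", OF M1.finite_mode]
      by (simp add: clinear_sum[OF lin2] clinear_scale[OF lin2] split_beta scaleC_complex_def)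
  qed
  have 3: "\<beta> \<psi> v (act_local M2 a (expand_at T \<rho> (mono_zero T \<zeta>) F) u) =
      (\<Sum>(p, q)\<in>Poly_Mapping.keys F. Poly_Mapping.lookup F (p, q) *
        Sum_any (\<lambda>l. coeff_zero T \<zeta> q l * R (q - of_nat l) * \<beta> \<psi> v (tmode M2 a (p + of_nat l) u)))"
  proof -
    have "\<beta> \<psi> v (Sum_any (\<lambda>l. (coeff_zero T \<zeta> q l * R (q - of_nat l)) *\<^sub>C tmode M2 a (p + of_nat l) u)) =
      Sum_any (\<lambda>l. coeff_zero T \<zeta> q l * R (q - of_nat l) * \<beta> \<psi> v (tmode M2 a (p + of_nat l) u))" for p q
    proof -
      have fin: "finite {l. (coeff_zero T \<zeta> q l * R (q - of_nat l)) *\<^sub>C tmode M2 a (p + of_nat l) u \<noteq> 0}"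
        by (rule finite_nonzero_imp[OF M2.finite_mode[of a p u]]) simp
      show ?thesis
        unfolding clinear_Sum_any[OF lin3 fin] by (simp add: clinear_scale[OF lin3] scaleC_complex_def)
    qed
    then show ?thesis
      unfolding act_local_def Sum_any_expand_at_zero[where Y = "\<lambda>k. tmode M2 a k u", OF M2.finite_mode]
      by (simp add: clinear_sum[OF lin3] clinear_scale[OF lin3] split_beta scaleC_complex_def)
  qed
  show "\<beta> (act_inf M3 a (expand_at T \<rho> mono_inf F) \<psi>) v u
       + \<beta> \<psi> (act_local M1 a (expand_at T \<rho> mono_w F) v) u
       + \<beta> \<psi> v (act_local M2 a (expand_at T \<rho> (mono_zero T \<zeta>) F) u) =
     (\<Sum>(p, q)\<in>Poly_Mapping.keys F. Poly_Mapping.lookup F (p, q) * ward_defect \<beta> a p q \<psi> v u)"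
    unfolding 1 2 3
    by (simp add: ward_defect_def \<beta>S sum.distrib[symmetric] sum_negf[symmetric] split_beta
        algebra_simps)
qed

end

end

end

section \<open>The dictionary between trilinear forms and modes\<close>

context block_setting
begin

text \<open>For homogeneous arguments the pairing of \<psi> with I(v,w)u consists, apart from
  w^(-h), of the single term \<psi>(v_(n)u) w^(-n-1); the factor \<open>R (n + 1)\<close> undoes the
  value of that power at \<open>\<rho>\<close>. Restricting the relation to homogeneous arguments
  avoids sums over n.\<close>

definition corresponds ::
    "(('m3 \<Rightarrow> complex) \<Rightarrow> 'm1 \<Rightarrow> 'm2 \<Rightarrow> complex) \<Rightarrow> ('m1 \<Rightarrow> rat \<Rightarrow> 'm2 \<Rightarrow> 'm3) \<Rightarrow> bool" where
  "corresponds \<beta> I \<longleftrightarrow> (\<forall>n1 n2 n3 n. \<forall>v\<in>tdeg M1 n1. \<forall>u\<in>tdeg M2 n2. \<forall>\<psi>\<in>dual_deg M3 n3.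
     \<psi> (I v n u) = (if n = n1 + n2 - n3 - 1 then R (n + 1) * \<beta> \<psi> v u else 0))"

lemma correspondsD:
  assumes "corresponds \<beta> I" "v \<in> tdeg M1 n1" "u \<in> tdeg M2 n2" "\<psi> \<in> dual_deg M3 n3"
  shows "\<psi> (I v n u) = (if n = n1 + n2 - n3 - 1 then R (n + 1) * \<beta> \<psi> v u else 0)"
  using assms unfolding corresponds_def by blast

text \<open>The form prescribes every matrix coefficient between homogeneous arguments, and
  functionals on the graded pieces separate points of M^3.\<close>

lemma corresponds_unique:
  assumes bil: "bilinear_modes I" "bilinear_modes I'"
    and corr: "corresponds \<beta> I" "corresponds \<beta> I'"
  shows "I = I'"
proof (intro ext)
  fix v n u
  note simps = modes_simps[OF bil(1)] modes_simps[OF bil(2)]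
  show "I v n u = I' v n u"
  proof (induction v rule: M1.module_induct)
    case v: (homogeneous n1 v)
    show ?case
    proof (induction u rule: M2.module_induct)
      case u: (homogeneous n2 u)
      have "I v n u - I' v n u = 0"
      proof (rule M3.dual_separates[OF finite_dim])
        fix n3 \<psi> assume \<psi>: "\<psi> \<in> dual_deg M3 n3"
        show "\<psi> (I v n u - I' v n u) = 0"
          using correspondsD[OF corr(1) v(2) u(2) \<psi>] correspondsD[OF corr(2) v(2) u(2) \<psi>]
          by (simp add: clinear_diff[OF M3.clinear_dual_deg[OF \<psi>]])
      qed
      then show ?case by simp
    qed (simp_all add: simps)
  qed (simp_all add: simps)
qed

lemma corresponds_form_unique:
  assumes tri: "trilinear_on D \<beta>" "trilinear_on D \<beta>'"
    and corr: "corresponds \<beta> I" "corresponds \<beta>' I" and \<psi>: "\<psi> \<in> D"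
  shows "\<beta> \<psi> v u = \<beta>' \<psi> v u"
  using \<psi>
proof (induction \<psi> rule: M3.contragredient_induct)
  case zero
  show ?case
    using clinear_on_zero[OF clinear_form1[OF tri(1)] M3.subspace_contragredient]
      clinear_on_zero[OF clinear_form1[OF tri(2)] M3.subspace_contragredient] by metis
next
  case (add x y)
  then show ?case
    using clinear_on_add[OF clinear_form1[OF tri(1)] add(1,2)]
      clinear_on_add[OF clinear_form1[OF tri(2)] add(1,2)] by metis
next
  case \<psi>: (homogeneous n3 \<psi>)
  note D = M3.dual_deg_subset[OF \<psi>(2)]
  note simps = clinear_zero[OF clinear_form2[OF tri(1) D]] clinear_zero[OF clinear_form2[OF tri(2) D]]
    clinear_zero[OF clinear_form3[OF tri(1) D]] clinear_zero[OF clinear_form3[OF tri(2) D]]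
    clinear_add[OF clinear_form2[OF tri(1) D]] clinear_add[OF clinear_form2[OF tri(2) D]]
    clinear_add[OF clinear_form3[OF tri(1) D]] clinear_add[OF clinear_form3[OF tri(2) D]]
  show ?case
  proof (induction v rule: M1.module_induct)
    case v: (homogeneous n1 v)
    show ?case
    proof (induction u rule: M2.module_induct)
      case u: (homogeneous n2 u)
      show ?case
        using correspondsD[OF corr(1) v(2) u(2) \<psi>(2), of "n1 + n2 - n3 - 1"]
          correspondsD[OF corr(2) v(2) u(2) \<psi>(2), of "n1 + n2 - n3 - 1"] R_nonzero
        by simp
    qed (simp_all add: simps)
  qed (simp_all add: simps)
qed

lemma corresponds_modes_exist:
  assumes tri: "trilinear_on D \<beta>"
  obtains I where "bilinear_modes I" "corresponds \<beta> I"
proof -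
  have "\<exists>B bd. finite B \<and> B \<subseteq> tdeg M3 n \<and> (\<forall>b. bd b \<in> dual_deg M3 n) \<and>
      (\<forall>\<psi>\<in>dual_deg M3 n. \<psi> = (\<Sum>b\<in>B. \<psi> b *\<^sub>C bd b))" for n
    by (rule M3.dual_basis[OF finite_dim[of n]]) blast
  then obtain B bd where "\<forall>n. finite (B n) \<and> B n \<subseteq> tdeg M3 n \<and> (\<forall>b. bd n b \<in> dual_deg M3 n) \<and>
      (\<forall>\<psi>\<in>dual_deg M3 n. \<psi> = (\<Sum>b\<in>B n. \<psi> b *\<^sub>C bd n b))"
    by metis
  then have B: "B n \<subseteq> tdeg M3 n" and bd: "bd n b \<in> dual_deg M3 n"
    and expand: "\<psi> \<in> dual_deg M3 n \<Longrightarrow> \<psi> = (\<Sum>b\<in>B n. \<psi> b *\<^sub>C bd n b)" for n b \<psi>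
    by blast+
  have bdD: "bd n b \<in> D" for n b by (rule M3.dual_deg_subset[OF bd])
  \<comment> \<open>The vector of M^3(n) that represents the functional sending \<psi> to
    \<open>\<beta> \<psi> v u\<close> on the dual of M^3(n): biduality in finite dimension, written
    out in a dual basis.\<close>
  define E where "E = (\<lambda>n v u. \<Sum>b\<in>B n. \<beta> (bd n b) v u *\<^sub>C b)"
  have E_left: "clinear (\<lambda>v. E n v u)" and E_right: "clinear (E n v)" for n v u
    unfolding E_def clinear_iff
    by (simp_all add: clinear_add[OF clinear_form2[OF tri bdD]] clinear_scale[OF clinear_form2[OF tri bdD]]
        clinear_add[OF clinear_form3[OF tri bdD]] clinear_scale[OF clinear_form3[OF tri bdD]]
        scaleC_add_left sum.distrib cvec.scale_sum_right scaleC_scaleC scaleC_complex_def)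
  have dual_E: "\<psi> (E n v u) = (if n' = n then \<beta> \<psi> v u else 0)" if \<psi>: "\<psi> \<in> dual_deg M3 n'" for \<psi> n n' v u
  proof -
    note lin = M3.clinear_dual_deg[OF \<psi>]
    have "\<psi> (E n v u) = (\<Sum>b\<in>B n. \<beta> (bd n b) v u * \<psi> b)"
      unfolding E_def clinear_sum[OF lin] clinear_scale[OF lin] by (simp add: scaleC_complex_def)
    also have "\<dots> = (if n' = n then \<beta> \<psi> v u else 0)"
    proof (cases "n' = n")
      case True
      have "\<beta> \<psi> v u = \<beta> (\<Sum>b\<in>B n. \<psi> b *\<^sub>C bd n b) v u"
        using expand[of \<psi> n] \<psi> True by simp
      also have "\<dots> = (\<Sum>b\<in>B n. \<beta> (\<psi> b *\<^sub>C bd n b) v u)"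
        by (rule clinear_on_sum[OF clinear_form1[OF tri] M3.subspace_contragredient])
           (rule cvec.subspace_scale[OF M3.subspace_contragredient bdD])
      also have "\<dots> = (\<Sum>b\<in>B n. \<beta> (bd n b) v u * \<psi> b)"
        unfolding clinear_on_scale[OF clinear_form1[OF tri] bdD] by (simp add: scaleC_complex_def mult.commute)
      finally show ?thesis using True by simp
    next
      case False
      then have "\<psi> b = 0" if "b \<in> B n" for b
        using M3.dual_deg_eq_zero_on[OF \<psi>, of b n] B[of n] that by auto
      then show ?thesis using False by simp
    qed
    finally show ?thesis .
  qed
  define cv where "cv = component (tdeg M1)"
  define cu where "cu = component (tdeg M2)"
  have cv: "clinear (cv i)" "finite {i. cv i v \<noteq> 0}" for i v
    unfolding cv_def by (rule clinear_component[OF M1.graded] finite_component[OF M1.graded])+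
  have cu: "clinear (cu i)" "finite {i. cu i u \<noteq> 0}" for i u
    unfolding cu_def by (rule clinear_component[OF M2.graded] finite_component[OF M2.graded])+
  \<comment> \<open>For v and u of degrees i and j the vector v_(n)u has to lie in degree i + j - n
    - 1, so only this piece of M^3 is used; arbitrary arguments are split into components.\<close>
  define f where "f = (\<lambda>n i j v u. R (n + 1) *\<^sub>C E (i + j - n - 1) (cv i v) (cu j u))"
  have f_zero: "f n i j v u = 0" if "cv i v = 0 \<or> cu j u = 0" for n i j v u
    using that by (auto simp: f_def clinear_zero[OF E_left] clinear_zero[OF E_right])
  have f_left: "clinear (\<lambda>v. f n i j v u)" for n i j u
    unfolding f_def clinear_iff
    by (simp add: clinear_add[OF cv(1)] clinear_scale[OF cv(1)] clinear_add[OF E_left]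
        clinear_scale[OF E_left] scaleC_add_right scaleC_scaleC mult.commute)
  have f_right: "clinear (\<lambda>u. f n i j v u)" for n i j v
    unfolding f_def clinear_iff
    by (simp add: clinear_add[OF cu(1)] clinear_scale[OF cu(1)] clinear_add[OF E_right]
        clinear_scale[OF E_right] scaleC_add_right scaleC_scaleC mult.commute)
  define g where "g = (\<lambda>n i v u. Sum_any (\<lambda>j. f n i j v u))"
  have g_left: "clinear (\<lambda>v. g n i v u)" for n i u
    unfolding g_def by (rule clinear_Sum_any_fun[OF f_left cu(2)[of u]]) (simp add: f_zero)
  \<comment> \<open>The indices j that contribute depend on u, so no fixed finite index set is
    available; the sum is instead seen as one over the components of u.\<close>
  have g_right: "clinear (\<lambda>u. g n i v u)" for n i v
  proof -
    have "g n i v u = Sum_any (\<lambda>j. (\<lambda>x. R (n + 1) *\<^sub>C E (i + j - n - 1) (cv i v) x) (cu j u))" for u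
      by (simp add: g_def f_def)
    moreover have "clinear (\<lambda>x. R (n + 1) *\<^sub>C E (i + j - n - 1) (cv i v) x)" for j
      unfolding clinear_iff
      by (simp add: clinear_add[OF E_right] clinear_scale[OF E_right] scaleC_add_right scaleC_scaleC mult.commute)
    ultimately show ?thesis
      using clinear_Sum_any_component[OF M2.graded, of "\<lambda>j x. R (n + 1) *\<^sub>C E (i + j - n - 1) (cv i v) x"]
      by (simp add: cu_def)
  qed
  define I where "I = (\<lambda>v n u. Sum_any (\<lambda>i. g n i v u))"
  have "bilinear_modes I"
    unfolding bilinear_modes_def
  proof (intro conjI allI)
    fix n u
    have "g n i v u = (\<lambda>x. Sum_any (\<lambda>j. R (n + 1) *\<^sub>C E (i + j - n - 1) x (cu j u))) (cv i v)" for i v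
      by (simp add: g_def f_def)
    moreover have "clinear (\<lambda>x. Sum_any (\<lambda>j. R (n + 1) *\<^sub>C E (i + j - n - 1) x (cu j u)))" for i
    proof (rule clinear_Sum_any_fun[OF _ cu(2)[of u]])
      show "clinear (\<lambda>x. R (n + 1) *\<^sub>C E (i + j - n - 1) x (cu j u))" for j
        unfolding clinear_iff
        by (simp add: clinear_add[OF E_left] clinear_scale[OF E_left] scaleC_add_right scaleC_scaleC mult.commute)
    qed (simp add: clinear_zero[OF E_right])
    ultimately show "clinear (\<lambda>v. I v n u)"
      unfolding I_def
      using clinear_Sum_any_component[OF M1.graded,
          of "\<lambda>i x. Sum_any (\<lambda>j. R (n + 1) *\<^sub>C E (i + j - n - 1) x (cu j u))"]
      by (simp add: cv_def)
  next
    fix v n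
    show "clinear (I v n)"
      unfolding I_def
      by (rule clinear_Sum_any_fun[OF g_right cv(2)[of v]]) (simp add: g_def f_zero)
  qed
  moreover have "corresponds \<beta> I"
    unfolding corresponds_def
  proof (intro allI ballI)
    fix n1 n2 n3 n v u \<psi>
    assume v: "v \<in> tdeg M1 n1" and u: "u \<in> tdeg M2 n2" and \<psi>: "\<psi> \<in> dual_deg M3 n3"
    have cv_v: "cv i v = (if i = n1 then v else 0)" for i
      unfolding cv_def by (rule component_homogeneous[OF M1.graded v])
    have cu_u: "cu i u = (if i = n2 then u else 0)" for i
      unfolding cu_def by (rule component_homogeneous[OF M2.graded u])
    have "I v n u = g n n1 v u"
      unfolding I_def by (rule Sum_any_single) (simp add: g_def f_zero cv_v)
    also have "\<dots> = f n n1 n2 v u"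
      unfolding g_def by (rule Sum_any_single) (simp add: f_zero cu_u)
    also have "\<dots> = R (n + 1) *\<^sub>C E (n1 + n2 - n - 1) v u" by (simp add: f_def cv_v cu_u)
    finally have "\<psi> (I v n u) = R (n + 1) * (if n3 = n1 + n2 - n - 1 then \<beta> \<psi> v u else 0)"
      by (simp add: clinear_scale[OF M3.clinear_dual_deg[OF \<psi>]] dual_E[OF \<psi>] scaleC_complex_def)
    then show "\<psi> (I v n u) = (if n = n1 + n2 - n3 - 1 then R (n + 1) * \<beta> \<psi> v u else 0)"
      by auto
  qed
  ultimately show ?thesis by (rule that)
qed

lemma corresponds_form_exists:
  assumes bil: "bilinear_modes I"
    and deg: "\<And>n1 n2 n v u. v \<in> tdeg M1 n1 \<Longrightarrow> u \<in> tdeg M2 n2 \<Longrightarrow> I v n u \<in> tdeg M3 (n1 + n2 - n - 1)"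
  obtains \<beta> where "trilinear_on D \<beta>" "corresponds \<beta> I"
proof -
  \<comment> \<open>The scalar is the value of w^(-n-1). Written as an inverse it cancels
    \<open>R (n + 1)\<close> for every rational n, also outside (1/T)Z.\<close>
  define \<beta> where "\<beta> = (\<lambda>(\<psi> :: 'm3 \<Rightarrow> complex) v u. Sum_any (\<lambda>n. inverse (R (n + 1)) *\<^sub>C \<psi> (I v n u)))"
  note lin = clinear_modes_left[OF bil] clinear_modes_right[OF bil]
  have zero: "\<psi> (I v n u) = 0" if "v \<in> tdeg M1 n1" "u \<in> tdeg M2 n2" "\<psi> \<in> dual_deg M3 n3"
    "n \<noteq> n1 + n2 - n3 - 1" for v n u \<psi> n1 n2 n3
  proof -
    have "n1 + n2 - n - 1 \<noteq> n3" using that(4) by auto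
    then show ?thesis by (rule M3.dual_deg_eq_zero_on[OF that(3) deg[OF that(1,2)]])
  qed
  \<comment> \<open>Homogeneous arguments leave at most one n; additivity in each argument then
    gives a finite set for all of them.\<close>
  have fin: "finite {n. \<psi> (I v n u) \<noteq> 0}" if "\<psi> \<in> D" for \<psi> v u
    using that
  proof (induction \<psi> rule: M3.contragredient_induct)
    case (add x y)
    then show ?case by (simp add: finite_nonzero_add)
  next
    case \<psi>: (homogeneous n3 \<psi>)
    note lin\<psi> = M3.clinear_dual_deg[OF \<psi>(2)]
    show ?case
    proof (induction v rule: M1.module_induct)
      case v: (homogeneous n1 v)
      show ?case
      proof (induction u rule: M2.module_induct)
        case u: (homogeneous n2 u)
        show ?case
          by (rule finite_subset[of _ "{n1 + n2 - n3 - 1}"]) (use zero[OF v(2) u(2) \<psi>(2)] in auto)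
      qed (simp_all add: modes_simps[OF bil] clinear_zero[OF lin\<psi>] clinear_add[OF lin\<psi>] finite_nonzero_add)
    qed (simp_all add: modes_simps[OF bil] clinear_zero[OF lin\<psi>] clinear_add[OF lin\<psi>] finite_nonzero_add)
  qed simp
  have fin': "finite {n. inverse (R (n + 1)) *\<^sub>C \<psi> (I v n u) \<noteq> 0}" if "\<psi> \<in> D" for \<psi> v u
    by (rule finite_nonzero_imp[OF fin[OF that, of v u]]) simp
  have "trilinear_on D \<beta>"
    unfolding trilinear_on_def clinear_on_def clinear_iff
  proof (intro conjI allI ballI)
    fix \<psi> \<psi>' v u c assume \<psi>: "\<psi> \<in> D" "\<psi>' \<in> D"
    show "\<beta> (\<psi> + \<psi>') v u = \<beta> \<psi> v u + \<beta> \<psi>' v u"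
      by (simp only: \<beta>_def plus_fun_apply scaleC_add_right
          Sum_any.distrib[OF fin'[OF \<psi>(1)] fin'[OF \<psi>(2)]])
  next
    fix \<psi> v u c
    show "\<beta> (c *\<^sub>C \<psi>) v u = c *\<^sub>C \<beta> \<psi> v u"
      by (simp add: \<beta>_def scaleC_fun_def scaleC_Sum_any scaleC_scaleC mult.commute)
  next
    fix \<psi> v v' u assume \<psi>: "\<psi> \<in> D"
    note lin\<psi> = M3.clinear_contragredient[OF \<psi>]
    show "\<beta> \<psi> (v + v') u = \<beta> \<psi> v u + \<beta> \<psi> v' u"
      by (simp only: \<beta>_def clinear_add[OF lin(1)] clinear_add[OF lin\<psi>] scaleC_add_right
          Sum_any.distrib[OF fin'[OF \<psi>] fin'[OF \<psi>]])
  next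
    fix \<psi> v u c assume \<psi>: "\<psi> \<in> D"
    note lin\<psi> = M3.clinear_contragredient[OF \<psi>]
    show "\<beta> \<psi> (c *\<^sub>C v) u = c *\<^sub>C \<beta> \<psi> v u"
      by (simp only: \<beta>_def clinear_scale[OF lin(1)] clinear_scale[OF lin\<psi>] scaleC_Sum_any
          scaleC_scaleC mult.commute)
  next
    fix \<psi> v u u' assume \<psi>: "\<psi> \<in> D"
    note lin\<psi> = M3.clinear_contragredient[OF \<psi>]
    show "\<beta> \<psi> v (u + u') = \<beta> \<psi> v u + \<beta> \<psi> v u'"
      by (simp only: \<beta>_def clinear_add[OF lin(2)] clinear_add[OF lin\<psi>] scaleC_add_right
          Sum_any.distrib[OF fin'[OF \<psi>] fin'[OF \<psi>]])
  next
    fix \<psi> v u c assume \<psi>: "\<psi> \<in> D"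
    note lin\<psi> = M3.clinear_contragredient[OF \<psi>]
    show "\<beta> \<psi> v (c *\<^sub>C u) = c *\<^sub>C \<beta> \<psi> v u"
      by (simp only: \<beta>_def clinear_scale[OF lin(2)] clinear_scale[OF lin\<psi>] scaleC_Sum_any
          scaleC_scaleC mult.commute)
  qed
  moreover have "corresponds \<beta> I"
    unfolding corresponds_def
  proof (intro allI ballI)
    fix n1 n2 n3 n v u \<psi>
    assume hom: "v \<in> tdeg M1 n1" "u \<in> tdeg M2 n2" "\<psi> \<in> dual_deg M3 n3"
    let ?n = "n1 + n2 - n3 - 1"
    have "\<beta> \<psi> v u = inverse (R (?n + 1)) *\<^sub>C \<psi> (I v ?n u)"
      unfolding \<beta>_def by (rule Sum_any_single) (simp add: zero[OF hom])
    then have "R (?n + 1) * \<beta> \<psi> v u = \<psi> (I v ?n u)"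
      using R_nonzero[of "?n + 1"] by (simp add: scaleC_complex_def)
    then show "\<psi> (I v n u) = (if n = ?n then R (n + 1) * \<beta> \<psi> v u else 0)"
      using zero[OF hom] by auto
  qed
  ultimately show ?thesis by (rule that)
qed

section \<open>Properties of modes that correspond to a form\<close>

context
  fixes \<beta> I
  assumes bil: "bilinear_modes I" and corr: "corresponds \<beta> I"
begin

text \<open>For n \<ge> n1 + n2 the target degree n1 + n2 - n - 1 is negative, so no functional
  detects the vector.\<close>

lemma corresponds_truncated: "truncated_modes I"
  unfolding truncated_modes_def
proof (intro allI)
  fix v u
  show "\<exists>N. \<forall>n\<ge>N. I v n u = 0"
  proof (induction v rule: M1.module_induct)
    case (add v v')
    then obtain N N' where "\<forall>n\<ge>N. I v n u = 0" "\<forall>n\<ge>N'. I v' n u = 0" by blast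
    then show ?case by (intro exI[of _ "max N N'"]) (simp add: modes_simps[OF bil])
  next
    case v: (homogeneous n1 v)
    show ?case
    proof (induction u rule: M2.module_induct)
      case (add u u')
      then obtain N N' where "\<forall>n\<ge>N. I v n u = 0" "\<forall>n\<ge>N'. I v n u' = 0" by blast
      then show ?case by (intro exI[of _ "max N N'"]) (simp add: modes_simps[OF bil])
    next
      case u: (homogeneous n2 u)
      have "I v n u = 0" if "n \<ge> n1 + n2" for n
      proof (rule M3.dual_separates[OF finite_dim])
        fix n3 \<psi> assume "of_nat T * n3 \<in> \<nat>" and \<psi>: "\<psi> \<in> dual_deg M3 n3"
        then have "n \<noteq> n1 + n2 - n3 - 1" using M3.degree_nonneg[of n3] that by auto
        then show "\<psi> (I v n u) = 0" using correspondsD[OF corr v(2) u(2) \<psi>, of n] by simp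
      qed
      then show ?case by blast
    qed (simp add: modes_simps[OF bil])
  qed (simp add: modes_simps[OF bil])
qed

lemma corresponds_exponents:
  assumes "\<not> integral_exponent n"
  shows "I v n u = 0"
proof (induction v rule: M1.module_induct)
  case v: (homogeneous n1 v)
  show ?case
  proof (induction u rule: M2.module_induct)
    case u: (homogeneous n2 u)
    show ?case
    proof (rule M3.dual_separates[OF finite_dim])
      fix n3 \<psi> assume n3: "of_nat T * n3 \<in> \<nat>" and \<psi>: "\<psi> \<in> dual_deg M3 n3"
      have "integral_exponent (n1 + n2 - n3 - 1)"
        by (intro integral_exponent_intros integral_exponent_Nats v u n3)
      then have "n \<noteq> n1 + n2 - n3 - 1" using assms by auto
      then show "\<psi> (I v n u) = 0" using correspondsD[OF corr v(2) u(2) \<psi>, of n] by simp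
    qed
  qed (simp_all add: modes_simps[OF bil])
qed (simp_all add: modes_simps[OF bil])

text \<open>Every homogeneous functional takes the same value on the vector and on its component in
  the expected degree, so the two agree by separation.\<close>

lemma corresponds_degree:
  assumes v: "v \<in> tdeg M1 n1" and u: "u \<in> tdeg M2 n2"
  shows "I v n u \<in> tdeg M3 (n1 + n2 - n - 1)"
proof -
  let ?n = "n1 + n2 - n - 1" and ?y = "I v n u"
  have "?y - component (tdeg M3) ?n ?y = 0"
  proof (rule M3.dual_separates[OF finite_dim])
    fix n3 \<psi> assume \<psi>: "\<psi> \<in> dual_deg M3 n3"
    note lin = M3.clinear_dual_deg[OF \<psi>]
    show "\<psi> (?y - component (tdeg M3) ?n ?y) = 0"
    proof (cases "n3 = ?n")
      case True
      then show ?thesis using M3.dual_deg_component[OF \<psi>, of ?y] by (simp add: clinear_diff[OF lin])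
    next
      case False
      then have "n \<noteq> n1 + n2 - n3 - 1" by auto
      then have "\<psi> ?y = 0" using correspondsD[OF corr v u \<psi>, of n] by simp
      moreover have "\<psi> (component (tdeg M3) ?n ?y) = 0"
        using M3.dual_deg_eq_zero_on[OF \<psi> component_mem[OF M3.graded, of ?n ?y]] False by simp
      ultimately show ?thesis by (simp add: clinear_diff[OF lin])
    qed
  qed
  then show ?thesis using component_mem[OF M3.graded, of ?n ?y] by simp
qed

context
  assumes tri: "trilinear_on D \<beta>"
begin

section \<open>Jacobi identity against invariance, for one monomial\<close>

context
  fixes a k p q
  assumes a: "a \<in> wt_space V k" and p: "integral_exponent p" and q: "integral_exponent q"
begin

text \<open>In each of the three sums the shift of the mode index by l is compensated by the degree
  shift of the acting mode of a. The condition for a nonzero matrix coefficient is therefore one and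
  the same value of m for all l and all three points.\<close>

lemma dual_jacobi_defect:
  assumes v: "v \<in> tdeg M1 n1" and u: "u \<in> tdeg M2 n2" and \<psi>: "\<psi> \<in> dual_deg M3 n3"
    and n: "of_nat T * n1 \<in> \<nat>" "of_nat T * n2 \<in> \<nat>" "of_nat T * n3 \<in> \<nat>"
  shows "\<psi> (jacobi_defect I a p q v u m) =
    (if m = n1 + n2 - n3 + of_nat k - p - q - 2 then - (R (m + 1) * ward_defect \<beta> a p q \<psi> v u) else 0)"
proof -
  note lin = M3.clinear_dual_deg[OF \<psi>] and trunc = corresponds_truncated
  let ?m = "n1 + n2 - n3 + of_nat k - p - q - 2"
  \<comment> \<open>All degrees and exponents lie in (1/T)Z, hence so does m + 1; this allows the
    common factor \<open>R (m + 1)\<close> to be split off from each power of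
    \<open>\<rho>\<close>.\<close>
  have m: "integral_exponent (?m + 1)"
    by (intro integral_exponent_intros integral_exponent_Nats p q n)
  have 1: "\<psi> (Sum_any (\<lambda>l. coeff_inf q l *\<^sub>C tmode M3 a (p + q - of_nat l) (I v (m + of_nat l) u))) =
    (if m = ?m then R (m + 1) * Sum_any (\<lambda>l. coeff_inf q l * R (of_nat l) *
        \<beta> (\<lambda>x. \<psi> (tmode M3 a (p + q - of_nat l) x)) v u) else 0)"
  proof -
    have "\<psi> (coeff_inf q l *\<^sub>C tmode M3 a (p + q - of_nat l) (I v (m + of_nat l) u)) =
      (if m = ?m then R (m + 1) * (coeff_inf q l * R (of_nat l) *
        \<beta> (\<lambda>x. \<psi> (tmode M3 a (p + q - of_nat l) x)) v u) else 0)" for l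
    proof -
      have "(\<lambda>x. \<psi> (tmode M3 a (p + q - of_nat l) x)) \<in> dual_deg M3 (n3 - of_nat k + (p + q - of_nat l) + 1)"
        by (rule M3.dual_deg_mode[OF \<psi> a])
      from correspondsD[OF corr v u this, of "m + of_nat l"]
      have "\<psi> (tmode M3 a (p + q - of_nat l) (I v (m + of_nat l) u)) =
        (if m = ?m then R ((m + 1) + of_nat l) * \<beta> (\<lambda>x. \<psi> (tmode M3 a (p + q - of_nat l) x)) v u else 0)"
        by (auto simp: algebra_simps)
      then show ?thesis
        using R_add[OF m, of "of_nat l"]
        by (auto simp: clinear_scale[OF lin] scaleC_complex_def integral_exponent_intros)
    qed
    then show ?thesis
      unfolding clinear_Sum_any[OF lin finite_defect_inf[OF bil trunc]] by (auto simp: mult_Sum_any)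
  qed
  have 2: "\<psi> (Sum_any (\<lambda>l. coeff_zero T \<zeta> q l *\<^sub>C I v (m + (q - of_nat l)) (tmode M2 a (p + of_nat l) u))) =
    (if m = ?m then R (m + 1) * Sum_any (\<lambda>l. coeff_zero T \<zeta> q l * R (q - of_nat l) *
        \<beta> \<psi> v (tmode M2 a (p + of_nat l) u)) else 0)"
  proof -
    have "\<psi> (coeff_zero T \<zeta> q l *\<^sub>C I v (m + (q - of_nat l)) (tmode M2 a (p + of_nat l) u)) =
      (if m = ?m then R (m + 1) * (coeff_zero T \<zeta> q l * R (q - of_nat l) *
        \<beta> \<psi> v (tmode M2 a (p + of_nat l) u)) else 0)" for l
    proof -
      have "tmode M2 a (p + of_nat l) u \<in> tdeg M2 (of_nat k - (p + of_nat l) - 1 + n2)"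
        by (rule M2.mode_degree[OF a u])
      from correspondsD[OF corr v this \<psi>, of "m + (q - of_nat l)"]
      have "\<psi> (I v (m + (q - of_nat l)) (tmode M2 a (p + of_nat l) u)) =
        (if m = ?m then R ((m + 1) + (q - of_nat l)) * \<beta> \<psi> v (tmode M2 a (p + of_nat l) u) else 0)"
        by (auto simp: algebra_simps)
      then show ?thesis
        using R_add[OF m, of "q - of_nat l"] q
        by (auto simp: clinear_scale[OF lin] scaleC_complex_def integral_exponent_intros)
    qed
    then show ?thesis
      unfolding clinear_Sum_any[OF lin finite_defect_zero[OF bil]] by (auto simp: mult_Sum_any)
  qed
  have 3: "\<psi> (Sum_any (\<lambda>l. coeff_w p l *\<^sub>C I (tmode M1 a (q + of_nat l) v) (m + (p - of_nat l)) u)) =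
    (if m = ?m then R (m + 1) * Sum_any (\<lambda>l. coeff_w p l * R (p - of_nat l) *
        \<beta> \<psi> (tmode M1 a (q + of_nat l) v) u) else 0)"
  proof -
    have "\<psi> (coeff_w p l *\<^sub>C I (tmode M1 a (q + of_nat l) v) (m + (p - of_nat l)) u) =
      (if m = ?m then R (m + 1) * (coeff_w p l * R (p - of_nat l) *
        \<beta> \<psi> (tmode M1 a (q + of_nat l) v) u) else 0)" for l
    proof -
      have "tmode M1 a (q + of_nat l) v \<in> tdeg M1 (of_nat k - (q + of_nat l) - 1 + n1)"
        by (rule M1.mode_degree[OF a v])
      from correspondsD[OF corr this u \<psi>, of "m + (p - of_nat l)"]
      have "\<psi> (I (tmode M1 a (q + of_nat l) v) (m + (p - of_nat l)) u) =
        (if m = ?m then R ((m + 1) + (p - of_nat l)) * \<beta> \<psi> (tmode M1 a (q + of_nat l) v) u else 0)"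
        by (auto simp: algebra_simps)
      then show ?thesis
        using R_add[OF m, of "p - of_nat l"] p
        by (auto simp: clinear_scale[OF lin] scaleC_complex_def integral_exponent_intros)
    qed
    then show ?thesis
      unfolding clinear_Sum_any[OF lin finite_defect_w[OF bil]] by (auto simp: mult_Sum_any)
  qed
  show ?thesis
    unfolding jacobi_defect_def clinear_diff[OF lin] 1 2 3 ward_defect_def
    by (simp add: distrib_left right_diff_distrib)
qed

text \<open>One direction tests the Jacobi defect in the single degree where it is visible; the
  other recovers a vector identity from its matrix coefficients, those in the remaining degrees
  being zero automatically.\<close>

lemma jacobi_iff_ward:
  "(\<forall>v u m. jacobi_defect I a p q v u m = 0) \<longleftrightarrow> (\<forall>\<psi>\<in>D. \<forall>v u. ward_defect \<beta> a p q \<psi> v u = 0)"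
proof
  assume jac: "\<forall>v u m. jacobi_defect I a p q v u m = 0"
  have "ward_defect \<beta> a p q \<psi> v u = 0" if "\<psi> \<in> D" for \<psi> v u
    using that
  proof (induction \<psi> rule: M3.contragredient_induct)
    case \<psi>: (homogeneous n3 \<psi>)
    note D = M3.dual_deg_subset[OF \<psi>(2)]
    show ?case
    proof (induction v rule: M1.module_induct)
      case v: (homogeneous n1 v)
      show ?case
      proof (induction u rule: M2.module_induct)
        case u: (homogeneous n2 u)
        let ?m = "n1 + n2 - n3 + of_nat k - p - q - 2"
        have "\<psi> (jacobi_defect I a p q v u ?m) = 0"
          using jac clinear_zero[OF M3.clinear_dual_deg[OF \<psi>(2)]] by simp
        then show ?case
          using dual_jacobi_defect[OF v(2) u(2) \<psi>(2) v(1) u(1) \<psi>(1), of ?m] R_nonzero by simp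
      qed (simp_all add: ward_defect_zero[OF tri a] ward_defect_add_right[OF tri a] D)
    qed (simp_all add: ward_defect_zero[OF tri a] ward_defect_add_middle[OF tri a] D)
  qed (simp_all only: ward_defect_zero[OF tri a] ward_defect_add_left[OF tri a] add_0)
  then show "\<forall>\<psi>\<in>D. \<forall>v u. ward_defect \<beta> a p q \<psi> v u = 0" by blast
next
  assume ward: "\<forall>\<psi>\<in>D. \<forall>v u. ward_defect \<beta> a p q \<psi> v u = 0"
  note simps = jacobi_defect_zero[OF bil corresponds_truncated]
    jacobi_defect_add_left[OF bil corresponds_truncated]
    jacobi_defect_add_right[OF bil corresponds_truncated]
  have "jacobi_defect I a p q v u m = 0" for v u m
  proof (induction v rule: M1.module_induct)
    case v: (homogeneous n1 v)
    show ?case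
    proof (induction u rule: M2.module_induct)
      case u: (homogeneous n2 u)
      show ?case
      proof (rule M3.dual_separates[OF finite_dim])
        fix n3 \<psi> assume n3: "of_nat T * n3 \<in> \<nat>" and \<psi>: "\<psi> \<in> dual_deg M3 n3"
        then have "ward_defect \<beta> a p q \<psi> v u = 0" using ward M3.dual_deg_subset by blast
        then show "\<psi> (jacobi_defect I a p q v u m) = 0"
          using dual_jacobi_defect[OF v(2) u(2) \<psi> v(1) u(1) n3, of m] by simp
      qed
    qed (simp_all add: simps)
  qed (simp_all add: simps)
  then show "\<forall>v u m. jacobi_defect I a p q v u m = 0" by blast
qed

end

end

end

end

section \<open>Tensors\<close>

lemma pure_tensor_mem: "a \<in> A \<Longrightarrow> pure_tensor A a b c \<in> tensor_space A"
  unfolding tensor_space_def by (rule cvec.span_base) blast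

lemma subspace_tensor_space: "cvec.subspace (tensor_space A)"
  unfolding tensor_space_def by (rule cvec.subspace_span)

lemma pure_tensor_add:
  "a \<in> A \<Longrightarrow> a' \<in> A \<Longrightarrow> pure_tensor A (a + a') b c = pure_tensor A a b c + pure_tensor A a' b c"
  "a \<in> A \<Longrightarrow> pure_tensor A a (b + b') c = pure_tensor A a b c + pure_tensor A a b' c"
  "a \<in> A \<Longrightarrow> pure_tensor A a b (c + c') = pure_tensor A a b c + pure_tensor A a b c'"
  by (auto simp: pure_tensor_def fun_eq_iff trilinear_on_def clinear_on_def clinear_iff)

lemma pure_tensor_scale:
  "a \<in> A \<Longrightarrow> pure_tensor A (k *\<^sub>C a) b c = k *\<^sub>C pure_tensor A a b c"
  "a \<in> A \<Longrightarrow> pure_tensor A a (k *\<^sub>C b) c = k *\<^sub>C pure_tensor A a b c"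
  "a \<in> A \<Longrightarrow> pure_tensor A a b (k *\<^sub>C c) = k *\<^sub>C pure_tensor A a b c"
  by (auto simp: pure_tensor_def fun_eq_iff trilinear_on_def clinear_on_def clinear_iff scaleC_fun_def)

lemma trilinear_on_pure_tensor:
  assumes A: "cvec.subspace A" and \<phi>: "clinear_on (tensor_space A) \<phi>"
  shows "trilinear_on A (\<lambda>a b c. \<phi> (pure_tensor A a b c))"
  unfolding trilinear_on_def clinear_on_def clinear_iff
  by (auto simp: pure_tensor_add pure_tensor_scale clinear_on_add[OF \<phi>] clinear_on_scale[OF \<phi>]
      pure_tensor_mem simp del: plus_fun_def)

section \<open>The correspondence\<close>

locale twisted_block_setting = block_setting V T M1 M2 M3 \<rho> \<zeta>
  for V :: "'v::complex_vec voa" and T :: nat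
    and M1 :: "('v, 'm1::complex_vec) tmod"
    and M2 :: "('v, 'm2::complex_vec) tmod"
    and M3 :: "('v, 'm3::complex_vec) tmod"
    and \<rho> \<zeta> :: complex +
  fixes g :: "'v \<Rightarrow> 'v" and \<epsilon> :: int and h1 h2 h3 :: complex
  assumes voa: "vertex_operator_algebra V" and aut: "voa_automorphism V g"
    and order: "fun_order g = T"
    and weight: "has_conformal_weight V M1 h1" "has_conformal_weight V M2 h2"
      "has_conformal_weight V M3 h3"
begin

abbreviation "blocks \<equiv> twisted_conformal_blocks V g \<epsilon> \<zeta> \<rho> M3 M1 M2"
abbreviation "intertwiners \<equiv> twisted_intertwining_operators V g \<epsilon> \<zeta> (h1 + h2 - h3) M3 M1 M2"

definition twisted_exponents :: "nat \<Rightarrow> rat \<Rightarrow> rat \<Rightarrow> bool" where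
  "twisted_exponents r p q \<longleftrightarrow>
     p - of_nat r / of_nat T \<in> \<int> \<and> q - of_int \<epsilon> * of_nat r / of_nat T \<in> \<int>"

lemma twisted_exponents_integral:
  assumes "twisted_exponents r p q"
  shows "integral_exponent p" "integral_exponent q"
proof -
  have T: "(of_nat T :: rat) \<noteq> 0" using M1.T_pos by simp
  obtain i j where "p = of_int i + of_nat r / of_nat T" "q = of_int j + of_int \<epsilon> * of_nat r / of_nat T"
    using assms unfolding twisted_exponents_def by (metis Ints_cases diff_add_cancel)
  then have "of_nat T * p = of_int (int T * i + int r)" "of_nat T * q = of_int (int T * j + \<epsilon> * int r)"
    using T by (simp_all add: field_simps)
  then show "integral_exponent p" "integral_exponent q"
    unfolding integral_exponent_def by (metis Ints_of_int)+
qed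

lemma twisted_laurent_iff:
  "F \<in> twisted_laurent T \<epsilon> r \<longleftrightarrow> (\<forall>(p, q)\<in>Poly_Mapping.keys F. twisted_exponents r p q)"
  by (simp add: twisted_laurent_def twisted_exponents_def)

lemma single_twisted_laurent:
  "twisted_exponents r p q \<Longrightarrow> Poly_Mapping.single (p, q) 1 \<in> twisted_laurent T \<epsilon> r"
  by (simp add: twisted_laurent_iff)

lemma weight_graded: "direct_sum_decomposition (wt_space V)"
  using voa by (simp add: vertex_operator_algebra_def)

lemma conformal_eigenspace: "conformal V \<in> eigenspace g 0"
  using aut by (simp add: voa_automorphism_def eigenspace_def scaleC_one)

lemma clinear_aut: "clinear g"
  using aut by (simp add: voa_automorphism_def)

text \<open>An automorphism fixes the conformal vector, so it commutes with L_0 and preserves its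
  eigenspaces, which are the weight spaces.\<close>

lemma automorphism_weight:
  assumes "a \<in> wt_space V k"
  shows "g a \<in> wt_space V k"
proof (rule eigenvector_mem[OF weight_graded, of "Vir V 0" "\<lambda>k. of_nat k"])
  have "\<forall>a n. clinear (vprod V a n)" using voa by (simp add: vertex_operator_algebra_def)
  then show "clinear (Vir V 0)" by (simp add: Vir_def)
  show eig: "Vir V 0 x = of_nat i *\<^sub>C x" if "x \<in> wt_space V i" for i x
    using voa that by (simp add: vertex_operator_algebra_def)
  have "Vir V 0 (g a) = g (Vir V 0 a)"
    using aut unfolding voa_automorphism_def Vir_def by metis
  also have "\<dots> = of_nat k *\<^sub>C g a"
    using eig[OF assms] by (simp add: clinear_scale[OF clinear_aut])
  finally show "Vir V 0 (g a) = of_nat k *\<^sub>C g a" .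
qed (auto simp: inj_on_def)

lemma component_automorphism: "component (wt_space V) k (g a) = g (component (wt_space V) k a)"
proof (induction a rule: graded_induct[OF weight_graded])
  case (3 i a)
  then show ?case
    using automorphism_weight[OF 3]
    by (simp add: component_homogeneous[OF weight_graded] clinear_zero[OF clinear_aut])
qed (simp_all add: clinear_zero[OF clinear_aut] clinear_add[OF clinear_aut]
    clinear_zero[OF clinear_component[OF weight_graded]]
    clinear_add[OF clinear_component[OF weight_graded]])

lemma component_eigenspace:
  assumes "a \<in> eigenspace g r"
  shows "component (wt_space V) k a \<in> eigenspace g r"
  using assms component_automorphism[of k a, symmetric]
  by (simp add: eigenspace_def clinear_scale[OF clinear_component[OF weight_graded]])

definition jacobi_identity :: "('m1 \<Rightarrow> rat \<Rightarrow> 'm2 \<Rightarrow> 'm3) \<Rightarrow> bool" where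
  "jacobi_identity I \<longleftrightarrow> (\<forall>r<T. \<forall>a\<in>eigenspace g r. \<forall>p q. twisted_exponents r p q \<longrightarrow>
     (\<forall>v u m. jacobi_defect I a p q v u m = 0))"

definition ward_identity :: "(('m3 \<Rightarrow> complex) \<Rightarrow> 'm1 \<Rightarrow> 'm2 \<Rightarrow> complex) \<Rightarrow> bool" where
  "ward_identity \<beta> \<longleftrightarrow> (\<forall>r<T. \<forall>a\<in>eigenspace g r. \<forall>k. a \<in> wt_space V k \<longrightarrow>
     (\<forall>p q. twisted_exponents r p q \<longrightarrow> (\<forall>\<psi>\<in>D. \<forall>v u. ward_defect \<beta> a p q \<psi> v u = 0)))"

text \<open>For homogeneous a this holds monomial by monomial. A general a in an eigenspace of g is
  a finite sum of weight components in the same eigenspace, and the Jacobi defect is additive in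
  a.\<close>

lemma jacobi_identity_iff_ward_identity:
  assumes tri: "trilinear_on D \<beta>" and bil: "bilinear_modes I" and corr: "corresponds \<beta> I"
  shows "jacobi_identity I \<longleftrightarrow> ward_identity \<beta>"
proof
  assume jac: "jacobi_identity I"
  show "ward_identity \<beta>"
    unfolding ward_identity_def
  proof (intro allI ballI impI)
    fix r a k p q \<psi> v u
    assume "r < T" "a \<in> eigenspace g r" "a \<in> wt_space V k" "twisted_exponents r p q" "\<psi> \<in> D"
    then show "ward_defect \<beta> a p q \<psi> v u = 0"
      using jac jacobi_iff_ward[OF bil corr tri, of a k p q] twisted_exponents_integral[of r p q]
      unfolding jacobi_identity_def by blast
  qed
next
  assume ward: "ward_identity \<beta>"
  note trunc = corresponds_truncated[OF bil corr]
  show "jacobi_identity I"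
    unfolding jacobi_identity_def
  proof (intro allI ballI impI)
    fix r a p q v u m
    assume r: "r < T" and a: "a \<in> eigenspace g r" and pq: "twisted_exponents r p q"
    let ?c = "\<lambda>k. component (wt_space V) k a"
    have hom: "jacobi_defect I (?c k) p q v u m = 0" for k
      using ward jacobi_iff_ward[OF bil corr tri component_mem[OF weight_graded] twisted_exponents_integral[OF pq],
          of k a] r component_eigenspace[OF a, of k] component_mem[OF weight_graded, of k a] pq
      unfolding ward_identity_def by blast
    have "jacobi_defect I (\<Sum>k\<in>A. ?c k) p q v u m = 0" for A
      by (induction A rule: infinite_finite_induct)
         (simp_all add: jacobi_defect_zero[OF bil trunc] jacobi_defect_add_vector[OF bil trunc] hom)
    then show "jacobi_defect I a p q v u m = 0"
      using Sum_any_component[OF weight_graded, of a] unfolding Sum_any.expand_set by metis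
  qed
qed

lemma jacobi_identity_iff:
  assumes bil: "bilinear_modes I" and trunc: "truncated_modes I"
  shows "jacobi_identity I \<longleftrightarrow>
    (\<forall>r<T. \<forall>a \<in> eigenspace g r. \<forall>F \<in> twisted_laurent T \<epsilon> r. \<forall>v u m.
        Sum_any (\<lambda>(k, e). expand mono_inf F k e *\<^sub>C tmode M3 a k (I v (m + e) u))
        - Sum_any (\<lambda>(k, e). expand (mono_zero T \<zeta>) F k e *\<^sub>C I v (m + e) (tmode M2 a k u))
        = Sum_any (\<lambda>(k, e). expand mono_w F k e *\<^sub>C I (tmode M1 a k v) (m + e) u))"
    (is "_ \<longleftrightarrow> ?rhs")
proof -
  let ?sum = "\<lambda>a F v u m. \<Sum>(p, q)\<in>Poly_Mapping.keys F. Poly_Mapping.lookup F (p, q) *\<^sub>C jacobi_defect I a p q v u m"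
  have rhs: "?rhs \<longleftrightarrow> (\<forall>r<T. \<forall>a \<in> eigenspace g r. \<forall>F \<in> twisted_laurent T \<epsilon> r. \<forall>v u m. ?sum a F v u m = 0)"
    unfolding jacobi_expand[OF bil trunc, symmetric] right_minus_eq ..
  show ?thesis
    unfolding rhs
  proof
    assume "jacobi_identity I"
    then show "\<forall>r<T. \<forall>a \<in> eigenspace g r. \<forall>F \<in> twisted_laurent T \<epsilon> r. \<forall>v u m. ?sum a F v u m = 0"
      by (auto simp: jacobi_identity_def twisted_laurent_iff split_beta intro!: sum.neutral)
  next
    assume *: "\<forall>r<T. \<forall>a \<in> eigenspace g r. \<forall>F \<in> twisted_laurent T \<epsilon> r. \<forall>v u m. ?sum a F v u m = 0"
    show "jacobi_identity I"
      unfolding jacobi_identity_def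
    proof (intro allI ballI impI)
      fix r a p q v u m assume "r < T" "a \<in> eigenspace g r" "twisted_exponents r p q"
      \<comment> \<open>A single monomial is itself an admissible F, so the sum reduces to one
        defect with coefficient 1.\<close>
      then have "?sum a (Poly_Mapping.single (p, q) 1) v u m = 0"
        using * single_twisted_laurent by blast
      then show "jacobi_defect I a p q v u m = 0" by simp
    qed
  qed
qed

section \<open>The L_{-1}-derivative property and homogeneity of modes\<close>

definition translation_identity :: "('m1 \<Rightarrow> rat \<Rightarrow> 'm2 \<Rightarrow> 'm3) \<Rightarrow> bool" where
  "translation_identity I \<longleftrightarrow> (\<forall>v n u.
     I (tmode M1 (conformal V) 0 v) n u = - ((of_rat n + (h1 + h2 - h3)) *\<^sub>C I v (n - 1) u))"

lemma intertwiners_iff: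
  "I \<in> intertwiners \<longleftrightarrow> bilinear_modes I \<and> (\<forall>v n. \<not> integral_exponent n \<longrightarrow> I v n = 0) \<and>
     truncated_modes I \<and> jacobi_identity I \<and> translation_identity I"
proof (cases "bilinear_modes I \<and> truncated_modes I")
  case True
  then show ?thesis
    unfolding twisted_intertwining_operators_def order Let_def mem_Collect_eq
      jacobi_identity_iff[OF conjunct1[OF True] conjunct2[OF True]]
    by (simp only: bilinear_modes_def truncated_modes_def integral_exponent_def translation_identity_def) blast
next
  case False
  then show ?thesis
    unfolding twisted_intertwining_operators_def Let_def mem_Collect_eq
      bilinear_modes_def truncated_modes_def by blast
qed

text \<open>With z = w + (z-w), the vanishing of this defect is the coefficient form of
  [L_0, I(v,w)] = I((w L_{-1} + L_0)v, w), modes 0 and 1 of the conformal vector being L_{-1} and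
  L_0. The exponent q = 0 leaves only l = 0 at \<infinity> and at 0, while p = 1 leaves l = 0 and l
  = 1 at w.\<close>

lemma jacobi_defect_conformal:
  "jacobi_defect I (conformal V) 1 0 v u m =
     tmode M3 (conformal V) 1 (I v m u) - I v m (tmode M2 (conformal V) 1 u)
     - (I (tmode M1 (conformal V) 0 v) (m + 1) u + I (tmode M1 (conformal V) 1 v) m u)"
proof -
  have c0: "(0 :: complex) gchoose l = (if l = 0 then 1 else 0)" for l
    by (cases l) auto
  have c1: "(1 :: complex) gchoose l = (if l = 0 \<or> l = 1 then 1 else 0)" for l
  proof -
    have "(1 :: complex) gchoose l = of_nat (1 choose l)"
      using binomial_gbinomial[of 1 l, where 'a = complex] by simp
    moreover have "1 choose l = 0" if "l \<noteq> 0" "l \<noteq> 1" using that by (intro binomial_eq_0) simp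
    ultimately show ?thesis by auto
  qed
  have 1: "Sum_any (\<lambda>l. coeff_inf 0 l *\<^sub>C tmode M3 (conformal V) (1 + 0 - of_nat l) (I v (m + of_nat l) u)) =
      tmode M3 (conformal V) 1 (I v m u)"
    by (subst Sum_any_single[of 0]) (auto simp: coeff_inf_def c0)
  have 2: "Sum_any (\<lambda>l. coeff_zero T \<zeta> 0 l *\<^sub>C I v (m + (0 - of_nat l)) (tmode M2 (conformal V) (1 + of_nat l) u)) =
      I v m (tmode M2 (conformal V) 1 u)"
    by (subst Sum_any_single[of 0]) (auto simp: coeff_zero_def c0)
  have 3: "Sum_any (\<lambda>l. coeff_w 1 l *\<^sub>C I (tmode M1 (conformal V) (0 + of_nat l) v) (m + (1 - of_nat l)) u) =
      I (tmode M1 (conformal V) 0 v) (m + 1) u + I (tmode M1 (conformal V) 1 v) m u"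
    by (subst Sum_any.expand_superset[of "{0, 1}"]) (auto simp: coeff_w_def c1)
  show ?thesis unfolding jacobi_defect_def 1 2 3 ..
qed

lemma conformal_commutator:
  assumes bil: "bilinear_modes I" and jac: "jacobi_identity I"
    and v: "v \<in> tdeg M1 n1" and u: "u \<in> tdeg M2 n2"
  shows "tmode M3 (conformal V) 1 (I v m u) =
    (h1 + h2 + of_rat (n1 + n2)) *\<^sub>C I v m u + I (tmode M1 (conformal V) 0 v) (m + 1) u"
proof -
  have "twisted_exponents 0 1 0" by (simp add: twisted_exponents_def)
  then have "jacobi_defect I (conformal V) 1 0 v u m = 0"
    using jac conformal_eigenspace M1.T_pos unfolding jacobi_identity_def by blast
  moreover have "tmode M1 (conformal V) 1 v = (h1 + of_rat n1) *\<^sub>C v"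
    "tmode M2 (conformal V) 1 u = (h2 + of_rat n2) *\<^sub>C u"
    using weight v u by (simp_all add: has_conformal_weight_def)
  ultimately have "tmode M3 (conformal V) 1 (I v m u) = (h2 + of_rat n2) *\<^sub>C I v m u
      + (I (tmode M1 (conformal V) 0 v) (m + 1) u + (h1 + of_rat n1) *\<^sub>C I v m u)"
    by (simp only: jacobi_defect_conformal clinear_scale[OF clinear_modes_left[OF bil]]
        clinear_scale[OF clinear_modes_right[OF bil]] diff_diff_eq right_minus_eq)
  then show ?thesis by (simp only: scaleC_add_left of_rat_add add_ac)
qed

text \<open>Substituting the derivative property into the commutator with L_0 shows that v_(m)u is
  an eigenvector of L_0, and the eigenvalue determines the degree.\<close>

lemma intertwiner_degree:
  assumes I: "I \<in> intertwiners" and v: "v \<in> tdeg M1 n1" and u: "u \<in> tdeg M2 n2"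
  shows "I v m u \<in> tdeg M3 (n1 + n2 - m - 1)"
proof (rule eigenvector_mem[OF M3.graded, of "tmode M3 (conformal V) 1" "\<lambda>n. h3 + of_rat n"])
  have bil: "bilinear_modes I" and jac: "jacobi_identity I" and tr: "translation_identity I"
    using I by (auto simp: intertwiners_iff)
  have L: "I (tmode M1 (conformal V) 0 v) (m + 1) u = - ((of_rat (m + 1) + (h1 + h2 - h3)) *\<^sub>C I v m u)"
    using tr unfolding translation_identity_def by (metis add_diff_cancel_right')
  \<comment> \<open>The shift by h_1 + h_2 - h_3 trades the weights of M^1 and M^2 for that of M^3;
    the index m + 1 of the L_{-1} term accounts for the final -1 in the degree.\<close>
  have "h1 + h2 + of_rat (n1 + n2) - (of_rat (m + 1) + (h1 + h2 - h3)) = h3 + of_rat (n1 + n2 - m - 1)"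
    by (simp add: of_rat_add of_rat_diff)
  then show "tmode M3 (conformal V) 1 (I v m u) = (h3 + of_rat (n1 + n2 - m - 1)) *\<^sub>C I v m u"
    unfolding conformal_commutator[OF bil jac v u] L
    by (simp only: diff_conv_add_uminus[symmetric] cvec.scale_left_diff_distrib[symmetric])
  show "clinear (tmode M3 (conformal V) 1)" by (rule M3.clinear_mode)
  show "tmode M3 (conformal V) 1 x = (h3 + of_rat i) *\<^sub>C x" if "x \<in> tdeg M3 i" for i x
    using weight(3) that by (simp add: has_conformal_weight_def)
qed (auto simp: inj_on_def)

text \<open>The converse of the degree computation: L_0 acts on v_(n-1)u by a scalar known from the
  degree, and comparison with the commutator formula isolates the L_{-1} term.\<close>

lemma translation_identity_of_degree:
  assumes bil: "bilinear_modes I" and jac: "jacobi_identity I"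
    and deg: "\<And>n1 n2 n v u. v \<in> tdeg M1 n1 \<Longrightarrow> u \<in> tdeg M2 n2 \<Longrightarrow> I v n u \<in> tdeg M3 (n1 + n2 - n - 1)"
  shows "translation_identity I"
  unfolding translation_identity_def
proof (intro allI)
  fix v n u
  note simps = modes_simps[OF bil] clinear_zero[OF M1.clinear_mode] clinear_add[OF M1.clinear_mode]
  show "I (tmode M1 (conformal V) 0 v) n u = - ((of_rat n + (h1 + h2 - h3)) *\<^sub>C I v (n - 1) u)"
  proof (induction v rule: M1.module_induct)
    case v: (homogeneous n1 v)
    show ?case
    proof (induction u rule: M2.module_induct)
      case u: (homogeneous n2 u)
      have "tmode M3 (conformal V) 1 (I v (n - 1) u) = (h3 + of_rat (n1 + n2 - (n - 1) - 1)) *\<^sub>C I v (n - 1) u"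
        using weight(3) deg[OF v(2) u(2), of "n - 1"] by (simp add: has_conformal_weight_def)
      then have "I (tmode M1 (conformal V) 0 v) n u =
          (h3 + of_rat (n1 + n2 - (n - 1) - 1)) *\<^sub>C I v (n - 1) u - (h1 + h2 + of_rat (n1 + n2)) *\<^sub>C I v (n - 1) u"
        using conformal_commutator[OF bil jac v(2) u(2), of "n - 1"] by (simp add: algebra_simps)
      moreover have "(h3 + of_rat (n1 + n2 - (n - 1) - 1)) - (h1 + h2 + of_rat (n1 + n2)) =
          - (of_rat n + (h1 + h2 - h3))"
        by (simp add: of_rat_add of_rat_diff)
      ultimately show ?case
        by (simp only: cvec.scale_left_diff_distrib[symmetric] cvec.scale_minus_left)
    qed (simp_all add: simps scaleC_add_right)
  qed (simp_all add: simps scaleC_add_right)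
qed

section \<open>Conformal blocks as invariant trilinear forms\<close>

definition block_form ::
    "(((('m3 \<Rightarrow> complex) \<Rightarrow> 'm1 \<Rightarrow> 'm2 \<Rightarrow> complex) \<Rightarrow> complex) \<Rightarrow> complex) \<Rightarrow>
     ('m3 \<Rightarrow> complex) \<Rightarrow> 'm1 \<Rightarrow> 'm2 \<Rightarrow> complex" where
  "block_form \<phi> = (\<lambda>\<psi> v u. \<phi> (pure_tensor D \<psi> v u))"

lemma trilinear_block_form: "clinear_on (tensor_space D) \<phi> \<Longrightarrow> trilinear_on D (block_form \<phi>)"
  unfolding block_form_def by (rule trilinear_on_pure_tensor[OF M3.subspace_contragredient])

definition chiral_generator ::
    "'v \<Rightarrow> (rat \<times> rat \<Rightarrow>\<^sub>0 complex) \<Rightarrow> ('m3 \<Rightarrow> complex) \<Rightarrow> 'm1 \<Rightarrow> 'm2 \<Rightarrow>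
     (('m3 \<Rightarrow> complex) \<Rightarrow> 'm1 \<Rightarrow> 'm2 \<Rightarrow> complex) \<Rightarrow> complex" where
  "chiral_generator a F \<psi> v u =
     pure_tensor D (act_inf M3 a (expand_at T \<rho> mono_inf F) \<psi>) v u
     + pure_tensor D \<psi> (act_local M1 a (expand_at T \<rho> mono_w F) v) u
     + pure_tensor D \<psi> v (act_local M2 a (expand_at T \<rho> (mono_zero T \<zeta>) F) u)"

lemma chiral_image_alt:
  "chiral_image V g \<epsilon> \<zeta> \<rho> M3 M1 M2 = cvec.span {chiral_generator a F \<psi> v u | a r j F \<psi> v u.
     r < T \<and> a \<in> eigenspace g r \<and> a \<in> wt_space V j \<and> F \<in> twisted_laurent T \<epsilon> r \<and> \<psi> \<in> D}"
  by (simp only: chiral_image_def order Let_def chiral_generator_def)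

lemma chiral_generator:
  assumes \<phi>: "clinear_on (tensor_space D) \<phi>" and a: "a \<in> wt_space V k" and \<psi>: "\<psi> \<in> D"
  shows "chiral_generator a F \<psi> v u \<in> tensor_space D"
    and "\<phi> (chiral_generator a F \<psi> v u) =
      (\<Sum>(p, q)\<in>Poly_Mapping.keys F. Poly_Mapping.lookup F (p, q) * ward_defect (block_form \<phi>) a p q \<psi> v u)"
proof -
  note tri = trilinear_block_form[OF \<phi>]
  note mem = pure_tensor_mem[OF act_inf_mem[OF tri a \<psi>]] pure_tensor_mem[OF \<psi>]
  note add = cvec.subspace_add[OF subspace_tensor_space]
  show "chiral_generator a F \<psi> v u \<in> tensor_space D"
    unfolding chiral_generator_def by (intro add mem)
  have "\<phi> (chiral_generator a F \<psi> v u) =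
      block_form \<phi> (act_inf M3 a (expand_at T \<rho> mono_inf F) \<psi>) v u
      + block_form \<phi> \<psi> (act_local M1 a (expand_at T \<rho> mono_w F) v) u
      + block_form \<phi> \<psi> v (act_local M2 a (expand_at T \<rho> (mono_zero T \<zeta>) F) u)"
    unfolding chiral_generator_def block_form_def
      clinear_on_add[OF \<phi> add[OF mem(1) mem(2)] mem(2)] clinear_on_add[OF \<phi> mem(1) mem(2)] ..
  then show "\<phi> (chiral_generator a F \<psi> v u) =
      (\<Sum>(p, q)\<in>Poly_Mapping.keys F. Poly_Mapping.lookup F (p, q) * ward_defect (block_form \<phi>) a p q \<psi> v u)"
    using ward_expand(2)[OF tri a \<psi>] by simp
qed

lemma blocks_iff:
  "\<phi> \<in> blocks \<longleftrightarrow> clinear_on (tensor_space D) \<phi> \<and> (\<forall>x. x \<notin> tensor_space D \<longrightarrow> \<phi> x = 0) \<and>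
     ward_identity (block_form \<phi>)"
proof -
  have "(\<forall>x\<in>chiral_image V g \<epsilon> \<zeta> \<rho> M3 M1 M2. \<phi> x = 0) \<longleftrightarrow> ward_identity (block_form \<phi>)"
    if \<phi>: "clinear_on (tensor_space D) \<phi>"
  proof
    assume *: "\<forall>x\<in>chiral_image V g \<epsilon> \<zeta> \<rho> M3 M1 M2. \<phi> x = 0"
    show "ward_identity (block_form \<phi>)"
      unfolding ward_identity_def
    proof (intro allI ballI impI)
      fix r a k p q \<psi> v u
      assume a: "r < T" "a \<in> eigenspace g r" "a \<in> wt_space V k" and pq: "twisted_exponents r p q" and \<psi>: "\<psi> \<in> D"
      let ?F = "Poly_Mapping.single (p, q) 1"
      have "chiral_generator a ?F \<psi> v u \<in> chiral_image V g \<epsilon> \<zeta> \<rho> M3 M1 M2"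
        unfolding chiral_image_alt by (rule cvec.span_base) (use a single_twisted_laurent[OF pq] \<psi> in blast)
      then have "\<phi> (chiral_generator a ?F \<psi> v u) = 0" using * by blast
      then show "ward_defect (block_form \<phi>) a p q \<psi> v u = 0"
        using chiral_generator(2)[OF \<phi> a(3) \<psi>, of ?F v u] by simp
    qed
  next
    assume ward: "ward_identity (block_form \<phi>)"
    \<comment> \<open>Membership is carried through the induction because \<phi> is linear only on
      the tensor space.\<close>
    have "x \<in> tensor_space D \<and> \<phi> x = 0" if "x \<in> chiral_image V g \<epsilon> \<zeta> \<rho> M3 M1 M2" for x
      using that unfolding chiral_image_alt
    proof (induction rule: cvec.span_induct_alt)
      case base
      show ?case using clinear_on_zero[OF \<phi> subspace_tensor_space] cvec.subspace_0[OF subspace_tensor_space] by blast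
    next
      case (step c x y)
      then obtain a r k F \<psi> v u where x: "x = chiral_generator a F \<psi> v u" and r: "r < T"
        and a: "a \<in> eigenspace g r" "a \<in> wt_space V k" and F: "F \<in> twisted_laurent T \<epsilon> r" and \<psi>: "\<psi> \<in> D"
        by blast
      have x_mem: "x \<in> tensor_space D" unfolding x by (rule chiral_generator(1)[OF \<phi> a(2) \<psi>])
      have "\<phi> x = 0"
        unfolding x chiral_generator(2)[OF \<phi> a(2) \<psi>]
      proof (rule sum.neutral, clarify)
        fix p q assume "(p, q) \<in> Poly_Mapping.keys F"
        then have "twisted_exponents r p q" using F unfolding twisted_laurent_iff by blast
        then have "ward_defect (block_form \<phi>) a p q \<psi> v u = 0"
          using ward r a \<psi> unfolding ward_identity_def by blast
        then show "Poly_Mapping.lookup F (p, q) * ward_defect (block_form \<phi>) a p q \<psi> v u = 0" by simp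
      qed
      then have "\<phi> (c *\<^sub>C x) = 0" using clinear_on_scale[OF \<phi> x_mem, of c] by simp
      moreover have cx: "c *\<^sub>C x \<in> tensor_space D"
        by (rule cvec.subspace_scale[OF subspace_tensor_space x_mem])
      moreover have y: "y \<in> tensor_space D" "\<phi> y = 0" using step.IH by simp_all
      ultimately show ?case
        using clinear_on_add[OF \<phi> cx y(1)] cvec.subspace_add[OF subspace_tensor_space cx y(1)]
        by (metis add_0)
    qed
    then show "\<forall>x\<in>chiral_image V g \<epsilon> \<zeta> \<rho> M3 M1 M2. \<phi> x = 0" by blast
  qed
  then show ?thesis unfolding twisted_conformal_blocks_def mem_Collect_eq by blast
qed

lemma subspace_blocks: "cvec.subspace blocks"
proof (rule cvec.subspaceI)
  show "0 \<in> blocks" by (simp add: twisted_conformal_blocks_def clinear_on_def)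
next
  fix \<phi> \<phi>' assume "\<phi> \<in> blocks" "\<phi>' \<in> blocks"
  then show "\<phi> + \<phi>' \<in> blocks"
    by (simp add: twisted_conformal_blocks_def clinear_on_def scaleC_add_right del: plus_fun_def)
next
  fix c \<phi> assume "\<phi> \<in> blocks"
  then show "c *\<^sub>C \<phi> \<in> blocks"
    by (simp add: twisted_conformal_blocks_def clinear_on_def scaleC_fun_def scaleC_add_right scaleC_scaleC mult.commute)
qed

section \<open>The isomorphism from blocks to intertwining operators\<close>

definition block_modes ::
    "(((('m3 \<Rightarrow> complex) \<Rightarrow> 'm1 \<Rightarrow> 'm2 \<Rightarrow> complex) \<Rightarrow> complex) \<Rightarrow> complex) \<Rightarrow>
     'm1 \<Rightarrow> rat \<Rightarrow> 'm2 \<Rightarrow> 'm3" where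
  "block_modes \<phi> = (THE I. bilinear_modes I \<and> corresponds (block_form \<phi>) I)"

lemma block_modes_eqI:
  "bilinear_modes I \<Longrightarrow> corresponds (block_form \<phi>) I \<Longrightarrow> block_modes \<phi> = I"
  unfolding block_modes_def using corresponds_unique by blast

lemma block_modes:
  assumes "\<phi> \<in> blocks"
  shows "bilinear_modes (block_modes \<phi>)" "corresponds (block_form \<phi>) (block_modes \<phi>)"
proof -
  have "trilinear_on D (block_form \<phi>)"
    using assms trilinear_block_form by (simp add: blocks_iff)
  then obtain I where "bilinear_modes I" "corresponds (block_form \<phi>) I"
    by (rule corresponds_modes_exist)
  with block_modes_eqI show "bilinear_modes (block_modes \<phi>)" "corresponds (block_form \<phi>) (block_modes \<phi>)"
    by metis+
qed

text \<open>The modes of a form are unique, so it is enough that sums and multiples of corresponding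
  pairs correspond again.\<close>

lemma clinear_block_modes: "clinear_on blocks block_modes"
  unfolding clinear_on_def
proof (intro conjI ballI allI)
  fix \<phi> \<phi>' assume \<phi>: "\<phi> \<in> blocks" and \<phi>': "\<phi>' \<in> blocks"
  note mode = block_modes[OF \<phi>] block_modes[OF \<phi>']
  show "block_modes (\<phi> + \<phi>') = block_modes \<phi> + block_modes \<phi>'"
  proof (rule block_modes_eqI)
    show "bilinear_modes (block_modes \<phi> + block_modes \<phi>')"
      using mode(1,3) by (simp add: bilinear_modes_def clinear_iff scaleC_add_right)
    show "corresponds (block_form (\<phi> + \<phi>')) (block_modes \<phi> + block_modes \<phi>')"
      unfolding corresponds_def
    proof (intro allI ballI)
      fix n1 n2 n3 n v u \<psi>
      assume hom: "v \<in> tdeg M1 n1" "u \<in> tdeg M2 n2" "\<psi> \<in> dual_deg M3 n3"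
      show "\<psi> ((block_modes \<phi> + block_modes \<phi>') v n u) =
        (if n = n1 + n2 - n3 - 1 then R (n + 1) * block_form (\<phi> + \<phi>') \<psi> v u else 0)"
        using correspondsD[OF mode(2) hom, of n] correspondsD[OF mode(4) hom, of n]
        by (simp add: clinear_add[OF M3.clinear_dual_deg[OF hom(3)]] block_form_def distrib_left)
    qed
  qed
next
  fix c \<phi> assume \<phi>: "\<phi> \<in> blocks"
  note mode = block_modes[OF \<phi>]
  show "block_modes (c *\<^sub>C \<phi>) = c *\<^sub>C block_modes \<phi>"
  proof (rule block_modes_eqI)
    show "bilinear_modes (c *\<^sub>C block_modes \<phi>)"
      using mode(1) by (simp add: bilinear_modes_def clinear_iff scaleC_fun_def scaleC_add_right scaleC_scaleC mult.commute)
    show "corresponds (block_form (c *\<^sub>C \<phi>)) (c *\<^sub>C block_modes \<phi>)"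
      unfolding corresponds_def
    proof (intro allI ballI)
      fix n1 n2 n3 n v u \<psi>
      assume hom: "v \<in> tdeg M1 n1" "u \<in> tdeg M2 n2" "\<psi> \<in> dual_deg M3 n3"
      show "\<psi> ((c *\<^sub>C block_modes \<phi>) v n u) =
        (if n = n1 + n2 - n3 - 1 then R (n + 1) * block_form (c *\<^sub>C \<phi>) \<psi> v u else 0)"
        using correspondsD[OF mode(2) hom, of n]
        by (simp add: clinear_scale[OF M3.clinear_dual_deg[OF hom(3)]] block_form_def scaleC_fun_def scaleC_complex_def)
    qed
  qed
qed

lemma block_modes_intertwiner:
  assumes \<phi>: "\<phi> \<in> blocks"
  shows "block_modes \<phi> \<in> intertwiners"
proof -
  note mode = block_modes[OF \<phi>]
  have tri: "trilinear_on D (block_form \<phi>)" and ward: "ward_identity (block_form \<phi>)"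
    using \<phi> trilinear_block_form by (simp_all add: blocks_iff)
  then have jac: "jacobi_identity (block_modes \<phi>)"
    using jacobi_identity_iff_ward_identity[OF tri mode] by blast
  show ?thesis
    unfolding intertwiners_iff
    using mode(1) corresponds_exponents[OF mode] corresponds_truncated[OF mode] jac
      translation_identity_of_degree[OF mode(1) jac corresponds_degree[OF mode]]
    by (auto simp: fun_eq_iff)
qed

lemma inj_block_modes: "inj_on block_modes blocks"
proof (rule inj_onI)
  fix \<phi> \<phi>' assume \<phi>: "\<phi> \<in> blocks" and \<phi>': "\<phi>' \<in> blocks" and eq: "block_modes \<phi> = block_modes \<phi>'"
  have lin: "clinear_on (tensor_space D) \<phi>" "clinear_on (tensor_space D) \<phi>'"
    using \<phi> \<phi>' by (simp_all add: blocks_iff)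
  have "block_form \<phi> \<psi> v u = block_form \<phi>' \<psi> v u" if "\<psi> \<in> D" for \<psi> v u
    by (rule corresponds_form_unique[OF trilinear_block_form[OF lin(1)] trilinear_block_form[OF lin(2)]
          block_modes(2)[OF \<phi>] _ that])
       (use block_modes(2)[OF \<phi>'] eq in simp)
  then have "\<phi> x = \<phi>' x" if "x \<in> tensor_space D" for x
    using tensor_space_lift_unique[OF lin _ that] unfolding block_form_def by blast
  \<comment> \<open>Blocks are zero off the tensor space by convention, so agreement there is
    automatic and equality of functions follows.\<close>
  moreover have "\<phi> x = \<phi>' x" if "x \<notin> tensor_space D" for x
    using \<phi> \<phi>' that by (simp add: blocks_iff)
  ultimately show "\<phi> = \<phi>'" by blast
qed

lemma surj_block_modes:
  assumes I: "I \<in> intertwiners"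
  shows "I \<in> block_modes ` blocks"
proof -
  have bil: "bilinear_modes I" and jac: "jacobi_identity I"
    using I by (simp_all add: intertwiners_iff)
  obtain \<beta> where \<beta>: "trilinear_on D \<beta>" "corresponds \<beta> I"
    using corresponds_form_exists[OF bil intertwiner_degree[OF I]] by blast
  \<comment> \<open>Tensors are realised as functions on trilinear forms, so the functional induced
    by \<open>\<beta>\<close> is evaluation at \<open>\<beta>\<close>, set to 0 off the tensor
    space.\<close>
  define \<phi> where "\<phi> = (\<lambda>x. if x \<in> tensor_space D then x \<beta> else 0)"
  have lin: "clinear_on (tensor_space D) \<phi>"
    unfolding clinear_on_def
  proof (intro conjI ballI allI)
    fix x y :: "(('m3 \<Rightarrow> complex) \<Rightarrow> 'm1 \<Rightarrow> 'm2 \<Rightarrow> complex) \<Rightarrow> complex"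
    assume xy: "x \<in> tensor_space D" "y \<in> tensor_space D"
    then have "x + y \<in> tensor_space D" by (rule cvec.subspace_add[OF subspace_tensor_space])
    with xy show "\<phi> (x + y) = \<phi> x + \<phi> y" by (simp add: \<phi>_def)
  next
    fix c and x :: "(('m3 \<Rightarrow> complex) \<Rightarrow> 'm1 \<Rightarrow> 'm2 \<Rightarrow> complex) \<Rightarrow> complex"
    assume "x \<in> tensor_space D"
    moreover from this have "c *\<^sub>C x \<in> tensor_space D"
      by (rule cvec.subspace_scale[OF subspace_tensor_space])
    moreover have "(c *\<^sub>C x) \<beta> = c *\<^sub>C x \<beta>" by (simp add: scaleC_fun_def)
    ultimately show "\<phi> (c *\<^sub>C x) = c *\<^sub>C \<phi> x" by (simp add: \<phi>_def)
  qed
  have form: "block_form \<phi> \<psi> v u = \<beta> \<psi> v u" if "\<psi> \<in> D" for \<psi> v u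
  proof -
    have "pure_tensor D \<psi> v u \<in> tensor_space D" by (rule pure_tensor_mem[OF that])
    then have "block_form \<phi> \<psi> v u = pure_tensor D \<psi> v u \<beta>" by (simp add: block_form_def \<phi>_def)
    then show ?thesis using \<beta>(1) by (simp add: pure_tensor_def)
  qed
  have corr: "corresponds (block_form \<phi>) I"
    unfolding corresponds_def
    by (intro allI ballI) (simp only: correspondsD[OF \<beta>(2)] form[OF M3.dual_deg_subset])
  have "ward_identity (block_form \<phi>)"
    using jacobi_identity_iff_ward_identity[OF trilinear_block_form[OF lin] bil corr] jac by blast
  then have "\<phi> \<in> blocks" using lin by (simp add: blocks_iff \<phi>_def)
  then show ?thesis using block_modes_eqI[OF bil corr] by blast
qed

theorem clinear_isomorphic_blocks_intertwiners: "clinear_isomorphic blocks intertwiners"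
proof -
  have image: "block_modes ` blocks = intertwiners"
    using block_modes_intertwiner surj_block_modes by blast
  then have "bij_betw block_modes blocks intertwiners"
    using inj_block_modes by (simp add: bij_betw_def)
  \<comment> \<open>Closure under linear combinations is inherited: the intertwining operators are
    the linear image of the subspace of blocks.\<close>
  moreover have "cvec.subspace intertwiners"
    using subspace_clinear_on_image[OF subspace_blocks clinear_block_modes] image by simp
  ultimately show ?thesis
    unfolding clinear_isomorphic_def using subspace_blocks clinear_block_modes by blast
qed

end


section \<open>Orders of automorphisms\<close>

lemma fun_order_pos: "finite_order g \<Longrightarrow> fun_order g > 0"
  and funpow_fun_order: "finite_order g \<Longrightarrow> g ^^ fun_order g = id"
  unfolding finite_order_def fun_order_def by (rule LeastI2_ex; blast)+

lemma fun_order_dvd: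
  assumes g: "finite_order g" and n: "g ^^ n = id"
  shows "fun_order g dvd n"
proof (rule ccontr)
  let ?o = "fun_order g"
  assume "\<not> ?o dvd n"
  then have "n mod ?o > 0" by (simp add: mod_greater_zero_iff_not_dvd)
  have "g ^^ n = g ^^ (n mod ?o + ?o * (n div ?o))" by simp
  also have "\<dots> = g ^^ (n mod ?o) \<circ> (g ^^ ?o) ^^ (n div ?o)"
    by (simp only: funpow_add funpow_mult)
  finally have "g ^^ (n mod ?o) = id" using n funpow_fun_order[OF g] by simp
  then have "?o \<le> n mod ?o"
    using \<open>n mod ?o > 0\<close> unfolding fun_order_def by (intro Least_le) blast
  moreover have "n mod ?o < ?o" using fun_order_pos[OF g] by simp
  ultimately show False by simp
qed

lemma fun_zpow_funpow_order:
  assumes "bij g" "g ^^ n = id"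
  shows "fun_zpow g k ^^ n = id"
proof -
  have "inv g ^^ n = id" using inv_fn[OF assms(1), of n] assms(2) by simp
  then show ?thesis
    using assms(2) by (simp add: fun_zpow_def funpow_mult mult.commute[of _ n] funpow_mult[symmetric])
qed

text \<open>f is an integral power of g, positive or negative, so it is killed by the order of
  g.\<close>

lemma fun_order_dvd_of_cyclic_group:
  assumes "bij g" "finite_order g" "finite_order f" "cyclic_group_of f = cyclic_group_of g"
  shows "fun_order f dvd fun_order g"
proof -
  have "f = fun_zpow f 1" by (simp add: fun_zpow_def)
  then have "f \<in> cyclic_group_of f" unfolding cyclic_group_of_def by (rule range_eqI)
  then have "f \<in> cyclic_group_of g" by (simp only: assms(4))
  then obtain k where "f = fun_zpow g k" by (auto simp: cyclic_group_of_def)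
  then have "f ^^ fun_order g = id"
    using fun_zpow_funpow_order[OF assms(1) funpow_fun_order[OF assms(2)]] by simp
  then show ?thesis by (rule fun_order_dvd[OF assms(3)])
qed

text \<open>Enlarging the denominator is harmless: if the order of g divides T, degrees in multiples
  of 1 over that order are also multiples of 1/T.\<close>

lemma graded_module_of_admissible:
  assumes adm: "admissible_twisted_module V g M" and T: "T > 0" "fun_order g dvd T"
  shows "graded_module V T M"
proof (rule graded_module.intro)
  show "T > 0" by (rule T)
  show "tdeg M n = {0}" if "of_nat T * n \<notin> \<nat>" for n :: rat
  proof -
    obtain d where d: "T = fun_order g * d" using T(2) by blast
    have "of_nat T * n = of_nat d * (of_nat (fun_order g) * n)" by (simp add: d)
    then have "of_nat (fun_order g) * n \<notin> \<nat>" using that Nats_mult[OF of_nat_in_Nats[of d]] by metis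
    then show ?thesis using adm by (simp add: admissible_twisted_module_def)
  qed
qed (use adm in \<open>simp_all add: admissible_twisted_module_def weak_twisted_module_def\<close>)

theorem theorem4:
  fixes V :: "'v::complex_vec voa"
    and g1 g2 g3 :: "'v \<Rightarrow> 'v"
    and M1 :: "('v, 'm1::complex_vec) tmod"
    and M2 :: "('v, 'm2::complex_vec) tmod"
    and M3 :: "('v, 'm3::complex_vec) tmod"
    and h1 h2 h3 w \<rho> \<zeta> :: complex
    and \<epsilon> :: int
  assumes "vertex_operator_algebra V"
    and "voa_automorphism V g1" "voa_automorphism V g2" "voa_automorphism V g3"
    and "finite_order g1" "finite_order g2" "finite_order g3"
    and "g1 \<circ> g2 = g3"
    and "(g1 = id \<and> \<epsilon> = 0 \<and> w = 1) \<or>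
         (cyclic_group_of g1 = cyclic_group_of g2 \<and> cyclic_group_of g2 = cyclic_group_of g3 \<and>
          g1 = fun_zpow g2 \<epsilon> \<and> w \<noteq> 0)"
    and "admissible_twisted_module V g1 M1" "has_conformal_weight V M1 h1"
    and "admissible_twisted_module V g2 M2" "has_conformal_weight V M2 h2"
    and "admissible_twisted_module V g3 M3" "has_conformal_weight V M3 h3"
    and "\<forall>n. cfinite_dim (tdeg M3 n)"
    and "\<rho> ^ fun_order g2 = w"
    and "\<zeta> ^ fun_order g2 = -1"
  shows "clinear_isomorphic
           (twisted_conformal_blocks V g2 \<epsilon> \<zeta> \<rho> M3 M1 M2)
           (twisted_intertwining_operators V g2 \<epsilon> \<zeta> (h1 + h2 - h3) M3 M1 M2)"
proof -
  have T: "fun_order g2 > 0" by (rule fun_order_pos[OF assms(6)])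
  have bij: "bij g2" using assms(3) by (simp add: voa_automorphism_def)
  have ord: "fun_order g1 dvd fun_order g2 \<and> fun_order g3 dvd fun_order g2 \<and> \<rho> \<noteq> 0"
    using assms(9)
  proof
    assume *: "g1 = id \<and> \<epsilon> = 0 \<and> w = 1"
    then have "fun_order g1 dvd fun_order g2" by (intro fun_order_dvd[OF assms(5)]) simp
    moreover have "g3 = g2" using assms(8) * by simp
    moreover have "\<rho> \<noteq> 0" using assms(17) * T by (auto simp: power_0_left)
    ultimately show ?thesis by simp
  next
    assume *: "cyclic_group_of g1 = cyclic_group_of g2 \<and> cyclic_group_of g2 = cyclic_group_of g3 \<and>
          g1 = fun_zpow g2 \<epsilon> \<and> w \<noteq> 0"
    then have "cyclic_group_of g1 = cyclic_group_of g2" "cyclic_group_of g3 = cyclic_group_of g2"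
      by metis+
    then have "fun_order g1 dvd fun_order g2" "fun_order g3 dvd fun_order g2"
      using fun_order_dvd_of_cyclic_group[OF bij assms(6)] assms(5,7) by blast+
    moreover have "\<rho> \<noteq> 0" using assms(17) * T by (auto simp: power_0_left)
    ultimately show ?thesis by simp
  qed
  interpret block: twisted_block_setting V "fun_order g2" M1 M2 M3 \<rho> \<zeta> g2 \<epsilon> h1 h2 h3
  proof (intro twisted_block_setting.intro block_setting.intro block_setting_axioms.intro
      twisted_block_setting_axioms.intro)
    show "graded_module V (fun_order g2) M1" "graded_module V (fun_order g2) M2"
      "graded_module V (fun_order g2) M3"
      using graded_module_of_admissible[OF assms(10) T] graded_module_of_admissible[OF assms(12) T]
        graded_module_of_admissible[OF assms(14) T] ord by simp_all
    show "\<rho> \<noteq> 0" "cfinite_dim (tdeg M3 n)" for n using ord assms(16) by simp_all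
  qed (fact assms refl)+
  show ?thesis by (rule block.clinear_isomorphic_blocks_intertwiners)
qed

end
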